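(* For any constant $k\geq 4$, $\mathrm{co}\mbox{-}2\mathrm{NCT}_k\subseteq 2\mathrm{NCT}_4$. Consequently $2\mathrm{NCT}_4=\mathrm{co}\mbox{-}2\mathrm{NCT}_4$.
   Context: A promise problem over a finite alphabet $\Sigma$ is a pair $(A,R)$ with $A,R\subseteq\Sigma^*$, $A\cap R=\varnothing$; we consider families $\mathcal{L}=\{(L_n^{(+)},L_n^{(-)})\}_{n\in\mathbb{N}}$ over a common alphabet. A $k$-counter two-way nondeterministic counter automaton (2ncta) is a two-way nondeterministic finite automaton (finite state set $Q$, input between endmarkers $\rhd,\lhd$, two-way read-only head) equipped with $k$ counters, each a stack with alphabet $\{1,\bot\}$ ($\bot$ a bottom marker). It solves $(A,R)$ if every $x\in A$ has an accepting computation path and for every $x\in R$ all (halting) computation paths are rejecting. A family $\{M_n\}$ is of polynomial size if $|Q_n|\le p(n)$ for a polynomial $p$. $2\mathrm{NCT}_k$ is the class of families $\mathcal{L}$ such that a polynomial-size family $\{M_n\}$ of $k$-counter 2ncta's has $M_n$ solving $(L_n^{(+)},L_n^{(-)})$ for every $n$. For a class $\mathcal{C}$, $\mathrm{co}\mbox{-}\mathcal{C}=\{\{(L_n^{(-)},L_n^{(+)})\}_{n}\mid \{(L_n^{(+)},L_n^{(-)})\}_n\in\mathcal{C}\}$. *)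

theory Defs
  imports "HOL-Computational_Algebra.Polynomial"
begin

datatype 'a tape_symbol = LeftEnd | Input 'a | RightEnd

datatype move = MoveLeft | Stay | MoveRight

datatype stack_symbol = One | Bottom

datatype stack_op = Push | Pop | Keep

record 'a ncta =
  states :: "nat set"
  init_state :: nat
  acc_states :: "nat set"
  rej_states :: "nat set"
  trans :: "nat \<Rightarrow> 'a tape_symbol \<Rightarrow> stack_symbol list \<Rightarrow> (nat \<times> move \<times> stack_op list) set"

definition halting_states :: "'a ncta \<Rightarrow> nat set" where
  "halting_states M = acc_states M \<union> rej_states M"

text \<open>
  A move reads the state, the scanned tape symbol and the list of the \<open>k\<close> topmost stack symbols.
  The head never leaves the tape, and the bottom marker of a counter is never removed.
  States are taken from \<^typ>\<open>nat\<close>, which only fixes the names of finitely many states.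
\<close>

definition is_ncta :: "nat \<Rightarrow> 'a ncta \<Rightarrow> bool" where
  "is_ncta k M \<longleftrightarrow>
     finite (states M) \<and> init_state M \<in> states M \<and>
     acc_states M \<subseteq> states M \<and> rej_states M \<subseteq> states M \<and>
     acc_states M \<inter> rej_states M = {} \<and>
     (\<forall>q \<in> states M - halting_states M. \<forall>a tops. length tops = k \<longrightarrow>
        (\<forall>(p, d, ops) \<in> trans M q a tops.
           p \<in> states M \<and> length ops = k \<and>
           (a = LeftEnd \<longrightarrow> d \<noteq> MoveLeft) \<and> (a = RightEnd \<longrightarrow> d \<noteq> MoveRight) \<and>
           (\<forall>i<k. tops ! i = Bottom \<longrightarrow> ops ! i \<noteq> Pop)))"

text \<open>
  A configuration consists of the state, the head position and the contents of the \<open>k\<close> counters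
  (head of a list = top of the stack).  The tape cells \<open>0, \<dots>, length x + 1\<close> contain the left
  endmarker, the input \<open>x\<close> and the right endmarker.
\<close>

type_synonym conf = "nat \<times> nat \<times> stack_symbol list list"

definition tape_at :: "'a list \<Rightarrow> nat \<Rightarrow> 'a tape_symbol" where
  "tape_at x h =
     (if h = 0 then LeftEnd else if h \<le> length x then Input (x ! (h - 1)) else RightEnd)"

fun move_head :: "move \<Rightarrow> nat \<Rightarrow> nat" where
  "move_head MoveLeft h = h - 1"
| "move_head Stay h = h"
| "move_head MoveRight h = h + 1"

fun apply_op :: "stack_op \<Rightarrow> stack_symbol list \<Rightarrow> stack_symbol list" where
  "apply_op Push s = One # s"
| "apply_op Pop s = tl s"
| "apply_op Keep s = s"

definition init_conf :: "nat \<Rightarrow> 'a ncta \<Rightarrow> conf" where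
  "init_conf k M = (init_state M, 0, replicate k [Bottom])"

definition step :: "'a ncta \<Rightarrow> 'a list \<Rightarrow> conf \<Rightarrow> conf \<Rightarrow> bool" where
  "step M x c c' \<longleftrightarrow>
     (case c of (q, h, ss) \<Rightarrow>
        q \<notin> halting_states M \<and>
        (\<exists>(p, d, ops) \<in> trans M q (tape_at x h) (map hd ss).
           c' = (p, move_head d h, map2 apply_op ops ss)))"

definition finite_path :: "nat \<Rightarrow> 'a ncta \<Rightarrow> 'a list \<Rightarrow> conf list \<Rightarrow> bool" where
  "finite_path k M x cs \<longleftrightarrow>
     cs \<noteq> [] \<and> hd cs = init_conf k M \<and> successively (step M x) cs"

definition infinite_path :: "nat \<Rightarrow> 'a ncta \<Rightarrow> 'a list \<Rightarrow> (nat \<Rightarrow> conf) \<Rightarrow> bool" where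
  "infinite_path k M x f \<longleftrightarrow> f 0 = init_conf k M \<and> (\<forall>i. step M x (f i) (f (Suc i)))"

definition maximal_path :: "nat \<Rightarrow> 'a ncta \<Rightarrow> 'a list \<Rightarrow> conf list \<Rightarrow> bool" where
  "maximal_path k M x cs \<longleftrightarrow> finite_path k M x cs \<and> (\<nexists>c. step M x (last cs) c)"

definition accepting_path :: "nat \<Rightarrow> 'a ncta \<Rightarrow> 'a list \<Rightarrow> conf list \<Rightarrow> bool" where
  "accepting_path k M x cs \<longleftrightarrow> finite_path k M x cs \<and> fst (last cs) \<in> acc_states M"

definition rejecting_path :: "nat \<Rightarrow> 'a ncta \<Rightarrow> 'a list \<Rightarrow> conf list \<Rightarrow> bool" where
  "rejecting_path k M x cs \<longleftrightarrow> finite_path k M x cs \<and> fst (last cs) \<in> rej_states M"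

text \<open>
  That all computation paths on \<open>x\<close> are rejecting is understood to include that all of them halt:
  there is no infinite path, and every maximal finite path ends in a rejecting state.  With two or
  more counters and no bound on the running time this matters: if infinite paths were tolerated on
  negative instances, the automata would be recognizers of recursively enumerable sets, and these
  are not closed under complement.
\<close>

definition all_paths_rejecting :: "nat \<Rightarrow> 'a ncta \<Rightarrow> 'a list \<Rightarrow> bool" where
  "all_paths_rejecting k M x \<longleftrightarrow>
     (\<nexists>f. infinite_path k M x f) \<and>
     (\<forall>cs. maximal_path k M x cs \<longrightarrow> rejecting_path k M x cs)"

type_synonym 'a promise_problem = "'a list set \<times> 'a list set"

type_synonym 'a family = "nat \<Rightarrow> 'a promise_problem"

definition is_promise_problem :: "'a promise_problem \<Rightarrow> bool" where
  "is_promise_problem P \<longleftrightarrow> fst P \<inter> snd P = {}"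

definition solves :: "nat \<Rightarrow> 'a ncta \<Rightarrow> 'a promise_problem \<Rightarrow> bool" where
  "solves k M P \<longleftrightarrow>
     (\<forall>x \<in> fst P. \<exists>cs. accepting_path k M x cs) \<and>
     (\<forall>x \<in> snd P. all_paths_rejecting k M x)"

definition polynomial_size :: "(nat \<Rightarrow> 'a ncta) \<Rightarrow> bool" where
  "polynomial_size M \<longleftrightarrow> (\<exists>p :: nat poly. \<forall>n. card (states (M n)) \<le> poly p n)"

text \<open>The common alphabet of a family is the finite type \<^typ>\<open>'a\<close>.\<close>

definition two_NCT :: "nat \<Rightarrow> 'a::finite family set" where
  "two_NCT k =
     {L. (\<forall>n. is_promise_problem (L n)) \<and>
         (\<exists>M. polynomial_size M \<and> (\<forall>n. is_ncta k (M n) \<and> solves k (M n) (L n)))}"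

definition co_class :: "'a family set \<Rightarrow> 'a family set" where
  "co_class C = {(\<lambda>n. (snd (L n), fst (L n))) | L. L \<in> C}"

end

theory Submission
  imports Defs "HOL-Library.Infinite_Set" "HOL-Computational_Algebra.Primes"
begin

text \<open>No running-time bound for the given automaton is available, so neither a depth bound nor
  a count of reachable configurations can certify that the tree is exhausted. The budget takes the
  place of such a bound. It need not bound the tree; it must only never run out before an accepting
  sequence is tried, and always run out when the tree is finite. Infinite branches on positive
  instances do no harm, because an accepting sequence has a finite number.

  The increment comes from the numeration. The first choice is the least significant digit, so
  appending a choice to a sequence of length \<open>L\<close> adds at most \<open>T * T^L\<close> to
  its number \<open>m\<close>, and \<open>T^L\<close> is at most \<open>T * m + 1\<close>; the
  resulting \<open>T * (T * m + 1)\<close> is rounded up to \<open>T * T * (m + 1)\<close>.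

  States and choices of the given automaton become register values and program text, never
  additional registers. The primes of the Goedel numbering are therefore constants for fixed
  \<open>k\<close>, and the passage to four counters multiplies the program size by a constant only.
  Since the new automaton is deterministic, reaching one rejecting configuration settles all of its
  paths.\<close>

text \<open>
  On a negative instance the tree of computations is finite, by Koenig's lemma; on a positive one
  an accepting computation is found by exhaustive search.  Hence a deterministic machine can decide
  the complement: it numbers the finite sequences of nondeterministic choices by
  \<open>m = 0, 1, 2, \<dots>\<close> in bijective base \<open>T\<close>, where \<open>T\<close> is the number of possible moves, and
  follows each of them.  An accepting computation makes it reject.  To detect that the tree is
  exhausted it keeps a budget, which decreases whenever sequence \<open>m\<close> leads to a dead computation
  and grows by \<open>T\<^sup>2 (m + 1)\<close> when the computation survives, and it accepts once the budget is used
  up.  If \<open>m\<close> is a proper prefix of an accepting sequence, the increase reaches the next longer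
  prefix; if the tree is finite, only finitely many sequences survive.

  The search is a while program with polynomially many instructions over a number of registers that
  depends only on \<open>k\<close>.  Goedel numbering packs the registers into one counter, with three more for
  multiplication, division and divisibility tests.
\<close>

section \<open>Register programs\<close>

datatype 'a com =
    Skip
  | Fail
  | Inc nat
  | Dec nat
  | Move move
  | Seq "'a com" "'a com" (infixr ";;" 60)
  | IfZero nat "'a com" "'a com"
  | IfTape "'a tape_symbol \<Rightarrow> bool" "'a com" "'a com"
  | While nat "'a com"

type_synonym store = "nat \<times> (nat \<Rightarrow> nat)"

text \<open>Makes every program compile to a legal automaton, without a side condition on its head
  moves.\<close>

fun clamp :: "move \<Rightarrow> 'a tape_symbol \<Rightarrow> move" where
  "clamp MoveLeft LeftEnd = Stay"
| "clamp MoveRight RightEnd = Stay"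
| "clamp d a = d"

text \<open>Only terminating executions are described. \<open>Fail\<close> and a \<open>Dec\<close>
  at zero have no rule, so an execution that meets them does not exist.\<close>

inductive exec :: "'a list \<Rightarrow> 'a com \<Rightarrow> store \<Rightarrow> store \<Rightarrow> bool" for x where
  Skip: "exec x Skip s s"
| Inc: "exec x (Inc r) (h, v) (h, v(r := Suc (v r)))"
| Dec: "v r \<noteq> 0 \<Longrightarrow> exec x (Dec r) (h, v) (h, v(r := v r - 1))"
| Move: "exec x (Move d) (h, v) (move_head (clamp d (tape_at x h)) h, v)"
| Seq: "exec x c s t \<Longrightarrow> exec x c' t u \<Longrightarrow> exec x (c ;; c') s u"
| IfZeroT: "v r = 0 \<Longrightarrow> exec x c (h, v) t \<Longrightarrow> exec x (IfZero r c c') (h, v) t"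
| IfZeroF: "v r \<noteq> 0 \<Longrightarrow> exec x c' (h, v) t \<Longrightarrow> exec x (IfZero r c c') (h, v) t"
| IfTapeT: "P (tape_at x h) \<Longrightarrow> exec x c (h, v) t \<Longrightarrow> exec x (IfTape P c c') (h, v) t"
| IfTapeF: "\<not> P (tape_at x h) \<Longrightarrow> exec x c' (h, v) t \<Longrightarrow> exec x (IfTape P c c') (h, v) t"
| WhileF: "v r = 0 \<Longrightarrow> exec x (While r c) (h, v) (h, v)"
| WhileT: "v r \<noteq> 0 \<Longrightarrow> exec x c (h, v) t \<Longrightarrow> exec x (While r c) t u
    \<Longrightarrow> exec x (While r c) (h, v) u"

lemma exec_iff:
  "exec x Skip s t \<longleftrightarrow> t = s"
  "exec x (Inc r) (h, v) t \<longleftrightarrow> t = (h, v(r := Suc (v r)))"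
  "exec x (Dec r) (h, v) t \<longleftrightarrow> v r \<noteq> 0 \<and> t = (h, v(r := v r - 1))"
  "exec x (Move d) (h, v) t \<longleftrightarrow> t = (move_head (clamp d (tape_at x h)) h, v)"
  "exec x (c ;; c') s t \<longleftrightarrow> (\<exists>u. exec x c s u \<and> exec x c' u t)"
  "exec x (IfZero r c c') (h, v) t \<longleftrightarrow> (if v r = 0 then exec x c (h, v) t else exec x c' (h, v) t)"
  "exec x (IfTape P c c') (h, v) t \<longleftrightarrow>
     (if P (tape_at x h) then exec x c (h, v) t else exec x c' (h, v) t)"
  by (subst exec.simps; auto)+

lemma exec_While_iff:
  "exec x (While r c) (h, v) t \<longleftrightarrow>
     (if v r = 0 then t = (h, v) else \<exists>u. exec x c (h, v) u \<and> exec x (While r c) u t)"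
  by (subst exec.simps) auto

lemma exec_det: "exec x c s t \<Longrightarrow> exec x c s u \<Longrightarrow> t = u"
proof (induction arbitrary: u rule: exec.induct)
  case (Seq c s t c' u')
  then show ?case by (metis exec_iff(5))
next
  case (WhileT v r c h t u')
  then show ?case by (metis exec_While_iff)
next
  case (WhileF v r c h)
  then show ?case by (simp add: exec_While_iff)
qed (simp_all add: exec_iff)

section \<open>Weakest preconditions for total correctness\<close>

definition wp :: "'a list \<Rightarrow> 'a com \<Rightarrow> (store \<Rightarrow> bool) \<Rightarrow> store \<Rightarrow> bool" where
  "wp x c Q s \<longleftrightarrow> (\<exists>t. exec x c s t \<and> Q t)"

text \<open>Determinism turns a known execution into an equivalence, so that it can be used as a
  rewrite rule under a surrounding program.\<close>

lemma wp_exec: "exec x c s t \<Longrightarrow> wp x c Q s \<longleftrightarrow> Q t"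
  unfolding wp_def using exec_det by blast

lemma wp_mono: "wp x c Q s \<Longrightarrow> (\<And>t. Q t \<Longrightarrow> Q' t) \<Longrightarrow> wp x c Q' s"
  unfolding wp_def by blast

text \<open>Equivalences for an arbitrary postcondition: the simplifier executes loop-free programs
  symbolically.\<close>

lemma wp_simps [simp]:
  "wp x Skip Q s \<longleftrightarrow> Q s"
  "wp x (Inc r) Q (h, v) \<longleftrightarrow> Q (h, v(r := Suc (v r)))"
  "wp x (Dec r) Q (h, v) \<longleftrightarrow> v r \<noteq> 0 \<and> Q (h, v(r := v r - 1))"
  "wp x (Move d) Q (h, v) \<longleftrightarrow> Q (move_head (clamp d (tape_at x h)) h, v)"
  "wp x (c ;; c') Q s \<longleftrightarrow> wp x c (wp x c' Q) s"
  "wp x (IfZero r c c') Q (h, v) \<longleftrightarrow> (if v r = 0 then wp x c Q (h, v) else wp x c' Q (h, v))"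
  "wp x (IfTape P c c') Q (h, v) \<longleftrightarrow>
     (if P (tape_at x h) then wp x c Q (h, v) else wp x c' Q (h, v))"
  unfolding wp_def exec_iff by auto

lemma wp_While_unfold:
  "wp x (While r c) Q (h, v) \<longleftrightarrow>
     (if v r = 0 then Q (h, v) else wp x c (wp x (While r c) Q) (h, v))"
  unfolding wp_def by (subst exec_While_iff) auto

text \<open>For the loop of the search, whose number of rounds has no closed form. The arithmetic
  loops are instead evaluated exactly by induction.\<close>

lemma wp_While:
  assumes "wf R" and "I s"
    and body: "\<And>h v. I (h, v) \<Longrightarrow> v r \<noteq> 0 \<Longrightarrow>
      wp x c (\<lambda>t. I t \<and> (t, (h, v)) \<in> R) (h, v)"
    and exit: "\<And>h v. I (h, v) \<Longrightarrow> v r = 0 \<Longrightarrow> Q (h, v)"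
  shows "wp x (While r c) Q s"
  using assms(1,2)
proof (induction s rule: wf_induct_rule)
  case (less s)
  obtain h v where s: "s = (h, v)" by fastforce
  show ?case
  proof (cases "v r = 0")
    case True
    then show ?thesis using less.prems exit s by (simp add: wp_While_unfold)
  next
    case False
    have "wp x c (\<lambda>t. I t \<and> (t, (h, v)) \<in> R) (h, v)"
      using body less.prems s False by blast
    then have "wp x c (wp x (While r c) Q) (h, v)"
      by (rule wp_mono) (use less.IH s in blast)
    with False s show ?thesis by (simp add: wp_While_unfold)
  qed
qed

text \<open>Chosen as a bound on the number of residual programs: a primitive instruction leaves
  itself and \<open>Skip\<close>, and a loop adds these two to the residuals of its body.\<close>

fun csize :: "'a com \<Rightarrow> nat" where
  "csize Skip = 1"
| "csize Fail = 1"
| "csize (c ;; c') = csize c + csize c'"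
| "csize (IfZero r c c') = Suc (csize c + csize c')"
| "csize (IfTape P c c') = Suc (csize c + csize c')"
| "csize (While r c) = Suc (Suc (csize c))"
| "csize c = 2"

fun regs :: "'a com \<Rightarrow> nat set" where
  "regs (Inc r) = {r}"
| "regs (Dec r) = {r}"
| "regs (c ;; c') = regs c \<union> regs c'"
| "regs (IfZero r c c') = insert r (regs c \<union> regs c')"
| "regs (IfTape P c c') = regs c \<union> regs c'"
| "regs (While r c) = insert r (regs c)"
| "regs c = {}"

section \<open>Compilation into four-counter automata\<close>

definition keeps :: "stack_op list" where
  "keeps = replicate 4 Keep"

text \<open>The control states of the compiled automaton are the residual programs.\<close>

fun nxt :: "'a com \<Rightarrow> 'a tape_symbol \<Rightarrow> stack_symbol list \<Rightarrow> 'a com \<times> move \<times> stack_op list" where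
  "nxt Skip a ts = (Skip, Stay, keeps)"
| "nxt Fail a ts = (Fail, Stay, keeps)"
| "nxt (Inc r) a ts = (Skip, Stay, keeps[r := Push])"
| "nxt (Dec r) a ts = (Skip, Stay, if ts ! r = One then keeps[r := Pop] else keeps)"
| "nxt (Move d) a ts = (Skip, clamp d a, keeps)"
| "nxt (c ;; c') a ts =
     (if c = Skip then (c', Stay, keeps)
      else (case nxt c a ts of (c1, d, ops) \<Rightarrow> (c1 ;; c', d, ops)))"
| "nxt (IfZero r c c') a ts = (if ts ! r = Bottom then c else c', Stay, keeps)"
| "nxt (IfTape P c c') a ts = (if P a then c else c', Stay, keeps)"
| "nxt (While r c) a ts = (if ts ! r = Bottom then Skip else c ;; While r c, Stay, keeps)"

text \<open>The analogue of the partial derivatives of a regular expression. The set stays finite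
  because a loop unfolds to its body followed by the very same loop.\<close>

fun residuals :: "'a com \<Rightarrow> 'a com set" where
  "residuals Skip = {Skip}"
| "residuals Fail = {Fail}"
| "residuals (c ;; c') = (\<lambda>d. d ;; c') ` residuals c \<union> residuals c'"
| "residuals (IfZero r c c') = insert (IfZero r c c') (residuals c \<union> residuals c')"
| "residuals (IfTape P c c') = insert (IfTape P c c') (residuals c \<union> residuals c')"
| "residuals (While r c) = {While r c, Skip} \<union> (\<lambda>d. d ;; While r c) ` residuals c"
| "residuals c = {c, Skip}"

lemma finite_residuals [simp]: "finite (residuals c)"
  by (induction c) auto

lemma residuals_self [simp]: "c \<in> residuals c"
  by (induction c) auto

lemma card_residuals: "card (residuals c) \<le> csize c"
proof (induction c)
  case (Seq c c')
  have "card (residuals (c ;; c')) \<le> card ((\<lambda>d. d ;; c') ` residuals c) + card (residuals c')"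
    by (simp add: card_Un_le)
  also have "card ((\<lambda>d. d ;; c') ` residuals c) \<le> card (residuals c)"
    by (rule card_image_le) simp
  finally show ?case using Seq by simp
next
  case (While r c)
  have "card (residuals (While r c)) \<le> 2 + card ((\<lambda>d. d ;; While r c) ` residuals c)"
    by (simp add: card_insert_if)
  also have "card ((\<lambda>d. d ;; While r c) ` residuals c) \<le> card (residuals c)"
    by (rule card_image_le) simp
  finally show ?case using While by simp
next
  case (IfZero r c c')
  then show ?case
    using card_Un_le[of "residuals c" "residuals c'"] by (simp add: card_insert_if)
next
  case (IfTape P c c')
  then show ?case
    using card_Un_le[of "residuals c" "residuals c'"] by (simp add: card_insert_if)
qed (auto simp: card_insert_if)

lemma residuals_nxt: "d \<in> residuals c \<Longrightarrow> fst (nxt d a ts) \<in> residuals c"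
proof (induction c arbitrary: d)
  case (Seq c c')
  show ?case
  proof (cases "d \<in> residuals c'")
    case True
    with Seq.IH(2) show ?thesis by simp
  next
    case False
    with Seq.prems obtain e where e: "e \<in> residuals c" "d = e ;; c'" by auto
    have "fst (nxt e a ts) \<in> residuals c" using Seq.IH(1) e by simp
    with e show ?thesis by (cases "nxt e a ts") auto
  qed
next
  case (While r c)
  show ?case
  proof (cases "d \<in> {While r c, Skip}")
    case True
    then show ?thesis by (cases "ts ! r = Bottom") auto
  next
    case False
    with While.prems obtain e where e: "e \<in> residuals c" "d = e ;; While r c" by auto
    have "fst (nxt e a ts) \<in> residuals c" using While.IH e by simp
    with e show ?thesis by (cases "nxt e a ts") auto
  qed
qed auto

lemma keeps_update_nth: "i < 4 \<Longrightarrow> keeps[r := opr] ! i = (if r = i then opr else Keep)"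
  by (cases "r = i") (simp_all add: keeps_def)

lemma keeps_nth: "i < 4 \<Longrightarrow> keeps ! i = Keep" and length_keeps [simp]: "length keeps = 4"
  by (simp_all add: keeps_def)

lemma nxt_wellformed:
  assumes "nxt c a ts = (c', d, ops)" and "length ts = 4"
  shows "length ops = 4 \<and> (a = LeftEnd \<longrightarrow> d \<noteq> MoveLeft) \<and> (a = RightEnd \<longrightarrow> d \<noteq> MoveRight)
    \<and> (\<forall>i<4. ts ! i = Bottom \<longrightarrow> ops ! i \<noteq> Pop)"
  using assms
proof (induction c arbitrary: c')
  case (Move d)
  then show ?case by (cases d; cases a) (auto simp: keeps_nth)
next
  case (Seq c1 c2)
  then show ?case by (auto simp: keeps_nth split: if_splits prod.splits)
qed (auto simp: keeps_nth keeps_update_nth split: if_splits)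

definition stack :: "nat \<Rightarrow> stack_symbol list" where
  "stack n = replicate n One @ [Bottom]"

lemma hd_stack: "hd (stack n) = (if n = 0 then Bottom else One)"
  by (cases n) (simp_all add: stack_def)

definition stacks :: "nat \<Rightarrow> (nat \<Rightarrow> nat) \<Rightarrow> stack_symbol list list" where
  "stacks k v = map (\<lambda>i. stack (v i)) [0..<k]"

definition tops :: "nat \<Rightarrow> (nat \<Rightarrow> nat) \<Rightarrow> stack_symbol list" where
  "tops k v = map (\<lambda>i. if v i = 0 then Bottom else One) [0..<k]"

lemma map_hd_stacks: "map hd (stacks k v) = tops k v"
  by (simp add: stacks_def tops_def hd_stack)

fun op_val :: "stack_op \<Rightarrow> nat \<Rightarrow> nat" where
  "op_val Push n = Suc n"
| "op_val Pop n = n - 1"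
| "op_val Keep n = n"

lemma apply_op_stack: "n = 0 \<longrightarrow> opr \<noteq> Pop \<Longrightarrow> apply_op opr (stack n) = stack (op_val opr n)"
  by (cases opr; cases n) (simp_all add: stack_def)

lemma map2_stacks:
  assumes "length ops = k" and "\<And>i. i < k \<Longrightarrow> v i = 0 \<Longrightarrow> ops ! i \<noteq> Pop"
    and "\<And>i. i < k \<Longrightarrow> v' i = op_val (ops ! i) (v i)"
  shows "map2 apply_op ops (stacks k v) = stacks k v'"
  by (rule nth_equalityI) (use assms in \<open>auto simp: stacks_def apply_op_stack\<close>)

text \<open>The step relation of the compiled automaton before its control states are renamed to
  numbers.\<close>

definition conf_step :: "'a list \<Rightarrow> 'a com \<times> nat \<times> stack_symbol list list
    \<Rightarrow> 'a com \<times> nat \<times> stack_symbol list list \<Rightarrow> bool" where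
  "conf_step x C C' \<longleftrightarrow>
     (case C of (c, h, ss) \<Rightarrow> c \<noteq> Skip \<and> c \<noteq> Fail \<and>
        (case nxt c (tape_at x h) (map hd ss) of (c', d, ops) \<Rightarrow>
           C' = (c', move_head d h, map2 apply_op ops ss)))"

lemma map2_keeps: "map2 apply_op keeps (stacks 4 v) = stacks 4 v"
  by (rule map2_stacks) (auto simp: keeps_nth)

lemmas rtranclp_induct_triple =
  rtranclp_induct[of _ "(ax, ay, az)" "(bx, by, bz)", split_rule, consumes 1, case_names refl step]
  for ax ay az bx "by" bz

lemma conf_step_Seq:
  "(conf_step x)\<^sup>*\<^sup>* (c, h, ss) (c', h', ss') \<Longrightarrow>
   (conf_step x)\<^sup>*\<^sup>* (c ;; d, h, ss) (c' ;; d, h', ss')"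
proof (induction rule: rtranclp_induct_triple)
  case (step c1 h1 ss1 c2 h2 ss2)
  have "conf_step x (c1 ;; d, h1, ss1) (c2 ;; d, h2, ss2)"
    using step(2) by (auto simp: conf_step_def split: prod.splits)
  with step show ?case by (meson rtranclp.rtrancl_into_rtrancl)
qed simp

lemma conf_step_Skip_Seq: "conf_step x (Skip ;; d, h, stacks 4 v) (d, h, stacks 4 v)"
  by (simp add: conf_step_def map2_keeps)

lemma tops_nth: "i < k \<Longrightarrow> tops k v ! i = (if v i = 0 then Bottom else One)"
  by (simp add: tops_def)

text \<open>Big steps are chained from small ones. As a \<open>Dec\<close> at zero has no execution,
  the branch of \<open>nxt\<close> that protects the bottom marker is not met here.\<close>

lemma exec_conf_steps:
  "exec x c s t \<Longrightarrow> regs c \<subseteq> {..<4} \<Longrightarrow>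
   (conf_step x)\<^sup>*\<^sup>* (c, fst s, stacks 4 (snd s)) (Skip, fst t, stacks 4 (snd t))"
proof (induction rule: exec.induct)
  case (Inc r h v)
  have "map2 apply_op (keeps[r := Push]) (stacks 4 v) = stacks 4 (v(r := Suc (v r)))"
    by (rule map2_stacks) (use Inc in \<open>auto simp: keeps_nth keeps_update_nth\<close>)
  then show ?case by (auto simp: conf_step_def fun_upd_def intro!: r_into_rtranclp)
next
  case (Dec v r h)
  then have "map2 apply_op (keeps[r := Pop]) (stacks 4 v) = stacks 4 (v(r := v r - 1))"
    by (intro map2_stacks) (auto simp: keeps_nth keeps_update_nth split: if_splits)
  with Dec show ?case
    by (auto simp: conf_step_def map_hd_stacks tops_nth fun_upd_def intro!: r_into_rtranclp)
next
  case (Move d h v)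
  show ?case by (auto simp: conf_step_def map2_keeps intro!: r_into_rtranclp)
next
  case (Seq c s t c' u)
  have "(conf_step x)\<^sup>*\<^sup>* (c ;; c', fst s, stacks 4 (snd s)) (Skip ;; c', fst t, stacks 4 (snd t))"
    using Seq by (intro conf_step_Seq) simp
  also have "conf_step x (Skip ;; c', fst t, stacks 4 (snd t)) (c', fst t, stacks 4 (snd t))"
    by (rule conf_step_Skip_Seq)
  also have "(conf_step x)\<^sup>*\<^sup>* (c', fst t, stacks 4 (snd t)) (Skip, fst u, stacks 4 (snd u))"
    using Seq by simp
  finally show ?case .
next
  case (IfZeroT v r c h t c')
  then have "conf_step x (IfZero r c c', h, stacks 4 v) (c, h, stacks 4 v)"
    by (auto simp: conf_step_def map_hd_stacks tops_nth map2_keeps)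
  with IfZeroT show ?case by (auto intro: converse_rtranclp_into_rtranclp)
next
  case (IfZeroF v r c' h t c)
  then have "conf_step x (IfZero r c c', h, stacks 4 v) (c', h, stacks 4 v)"
    by (auto simp: conf_step_def map_hd_stacks tops_nth map2_keeps)
  with IfZeroF show ?case by (auto intro: converse_rtranclp_into_rtranclp)
next
  case (IfTapeT P h c v t c')
  then have "conf_step x (IfTape P c c', h, stacks 4 v) (c, h, stacks 4 v)"
    by (auto simp: conf_step_def map2_keeps)
  with IfTapeT show ?case by (auto intro: converse_rtranclp_into_rtranclp)
next
  case (IfTapeF P h c' v t c)
  then have "conf_step x (IfTape P c c', h, stacks 4 v) (c', h, stacks 4 v)"
    by (auto simp: conf_step_def map2_keeps)
  with IfTapeF show ?case by (auto intro: converse_rtranclp_into_rtranclp)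
next
  case (WhileF v r c h)
  then have "conf_step x (While r c, h, stacks 4 v) (Skip, h, stacks 4 v)"
    by (auto simp: conf_step_def map_hd_stacks tops_nth map2_keeps)
  then show ?case by auto
next
  case (WhileT v r c h t u)
  have "conf_step x (While r c, h, stacks 4 v) (c ;; While r c, h, stacks 4 v)"
    using WhileT by (auto simp: conf_step_def map_hd_stacks tops_nth map2_keeps)
  also have "(conf_step x)\<^sup>*\<^sup>* (c ;; While r c, h, stacks 4 v)
      (Skip ;; While r c, fst t, stacks 4 (snd t))"
    using WhileT by (intro conf_step_Seq) simp
  also have "conf_step x (Skip ;; While r c, fst t, stacks 4 (snd t))
      (While r c, fst t, stacks 4 (snd t))"
    by (rule conf_step_Skip_Seq)
  also have "(conf_step x)\<^sup>*\<^sup>* (While r c, fst t, stacks 4 (snd t)) (Skip, fst u, stacks 4 (snd u))"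
    using WhileT by simp
  finally show ?case by simp
qed simp

section \<open>Computation paths and reachability\<close>

lemma finite_path_iff_reachable:
  "(\<exists>cs. finite_path k M x cs \<and> last cs = c) \<longleftrightarrow> (step M x)\<^sup>*\<^sup>* (init_conf k M) c"
proof
  assume "\<exists>cs. finite_path k M x cs \<and> last cs = c"
  then obtain cs where "finite_path k M x cs" "last cs = c" by blast
  then show "(step M x)\<^sup>*\<^sup>* (init_conf k M) c"
  proof (induction cs arbitrary: c rule: rev_induct)
    case (snoc a cs)
    show ?case
    proof (cases "cs = []")
      case True
      with snoc show ?thesis by (simp add: finite_path_def)
    next
      case False
      with snoc.prems have "finite_path k M x cs" "step M x (last cs) c"
        by (auto simp: finite_path_def successively_append_iff)
      with snoc.IH show ?thesis by (meson rtranclp.rtrancl_into_rtrancl)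
    qed
  qed (simp add: finite_path_def)
next
  assume "(step M x)\<^sup>*\<^sup>* (init_conf k M) c"
  then show "\<exists>cs. finite_path k M x cs \<and> last cs = c"
  proof induction
    case base
    show ?case by (rule exI[of _ "[init_conf k M]"]) (simp add: finite_path_def)
  next
    case (step c d)
    then obtain cs where "finite_path k M x cs" "last cs = c" by blast
    with step(2) have "finite_path k M x (cs @ [d])"
      by (auto simp: finite_path_def successively_append_iff)
    then show ?case by (metis last_snoc)
  qed
qed

text \<open>Everything reachable lies on the single path leading to \<open>c\<close>, where the
  computation halts.\<close>

lemma all_paths_rejecting_if_deterministic:
  assumes det: "\<And>c d d'. step M x c d \<Longrightarrow> step M x c d' \<Longrightarrow> d = d'"
    and reach: "(step M x)\<^sup>*\<^sup>* (init_conf k M) c" and rej: "fst c \<in> rej_states M"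
  shows "all_paths_rejecting k M x"
proof -
  have halt: "\<not> step M x c d" for d
    using rej by (auto simp: step_def halting_states_def)
  \<comment> \<open>A reachable configuration other than \<open>c\<close> has its unique successor
    on the way to \<open>c\<close>, so the property is passed on along each step.\<close>
  have towards: "(step M x)\<^sup>*\<^sup>* e c" if "(step M x)\<^sup>*\<^sup>* (init_conf k M) e" for e
    using that
  proof induction
    case (step e f)
    from step.IH step.hyps(2) show ?case
      by (cases rule: converse_rtranclpE) (use halt det in blast)+
  qed (rule reach)
  have "\<not> infinite_path k M x f" for f
  proof
    assume inf: "infinite_path k M x f"
    \<comment> \<open>Induction on the distance to \<open>c\<close>: an infinite path through
      \<open>e\<close> would follow the unique successors and arrive at \<open>c\<close>, which has
      none.\<close>
    have "(step M x)\<^sup>*\<^sup>* e c \<Longrightarrow> e \<noteq> f i" for e i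
    proof (induction arbitrary: i rule: converse_rtranclp_induct)
      case base
      then show ?case using inf halt by (metis infinite_path_def)
    next
      case (step y z)
      then show ?case using inf det by (metis infinite_path_def)
    qed
    with reach inf show False by (metis infinite_path_def)
  qed
  moreover have "rejecting_path k M x cs" if "maximal_path k M x cs" for cs
  proof -
    have "(step M x)\<^sup>*\<^sup>* (init_conf k M) (last cs)"
      using that finite_path_iff_reachable unfolding maximal_path_def by blast
    then have "(step M x)\<^sup>*\<^sup>* (last cs) c" by (rule towards)
    then have "last cs = c"
      using that unfolding maximal_path_def by (meson converse_rtranclpE)
    then show ?thesis using that rej by (simp add: rejecting_path_def maximal_path_def)
  qed
  ultimately show ?thesis unfolding all_paths_rejecting_def by blast
qed

text \<open>The residual programs are numbered injectively to serve as states; \<open>Skip\<close>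
  becomes the accepting and \<open>Fail\<close> the rejecting state.\<close>

lemma compile:
  fixes P :: "'a com"
  obtains N :: "'a ncta" where "is_ncta 4 N" "card (states N) \<le> csize P + 2"
    "\<And>x h ss. (conf_step x)\<^sup>*\<^sup>* (P, 0, stacks 4 (\<lambda>_. 0)) (Skip, h, ss) \<Longrightarrow>
       \<exists>cs. accepting_path 4 N x cs"
    "\<And>x h ss. (conf_step x)\<^sup>*\<^sup>* (P, 0, stacks 4 (\<lambda>_. 0)) (Fail, h, ss) \<Longrightarrow>
       all_paths_rejecting 4 N x"
proof -
  \<comment> \<open>\<open>Skip\<close> and \<open>Fail\<close> are adjoined because both halting
    states must exist even if the program cannot reach them.\<close>
  define S where "S = residuals P \<union> {Skip, Fail}"
  have fin: "finite S" by (simp add: S_def)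
  then obtain f :: "'a com \<Rightarrow> nat" where f: "inj_on f S"
    using finite_imp_inj_to_nat_seg by blast
  define g where "g = the_inv_into S f"
  have gf: "g (f c) = c" if "c \<in> S" for c
    using that f by (simp add: g_def the_inv_into_f_f)
  have feq: "f c = f d \<longleftrightarrow> c = d" if "c \<in> S" "d \<in> S" for c d
    using that f by (auto dest: inj_onD)
  have mem: "Skip \<in> S" "Fail \<in> S" "P \<in> S" by (auto simp: S_def)
  have nxtS: "c' \<in> S" if "c \<in> S" "nxt c a ts = (c', d, ops)" for c c' d ops a ts
    using that residuals_nxt[of c P a ts] by (auto simp: S_def)
  define N :: "'a ncta" where "N = \<lparr>states = f ` S, init_state = f P, acc_states = {f Skip},
    rej_states = {f Fail},
    trans = (\<lambda>q a ts. case nxt (g q) a ts of (c, d, ops) \<Rightarrow> {(f c, d, ops)})\<rparr>"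
  have nc: "is_ncta 4 N"
    unfolding is_ncta_def using fin mem nxtS
    by (auto simp: N_def feq gf split: prod.splits dest: nxt_wellformed)
  have "card (states N) \<le> card S"
    by (simp add: N_def card_image_le fin)
  also have "\<dots> \<le> card (residuals P) + card {Skip, Fail :: 'a com}"
    unfolding S_def by (rule card_Un_le)
  also have "\<dots> \<le> csize P + 2"
    using card_residuals[of P] by simp
  finally have size: "card (states N) \<le> csize P + 2" .
  have stepN: "step N x (f c, h, ss) (f c', h', ss') \<and> c' \<in> S"
    if "conf_step x (c, h, ss) (c', h', ss')" "c \<in> S" for x c h ss c' h' ss'
    using that mem nxtS[OF that(2)]
    by (auto simp: conf_step_def step_def halting_states_def N_def gf feq split: prod.splits)
  have det: "d = d'" if "step N x c d" "step N x c d'" for x c d d'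
    using that by (auto simp: step_def N_def split: prod.splits)
  have reach: "(step N x)\<^sup>*\<^sup>* (init_conf 4 N) (f c, h, ss) \<and> c \<in> S"
    if "(conf_step x)\<^sup>*\<^sup>* (P, 0, stacks 4 (\<lambda>_. 0)) (c, h, ss)" for x c h ss
    using that
  proof (induction rule: rtranclp_induct_triple)
    case refl
    have "init_conf 4 N = (f P, 0, stacks 4 (\<lambda>_. 0))"
      by (simp add: init_conf_def N_def stacks_def stack_def map_replicate_const)
    then show ?case using mem by simp
  next
    case (step c1 h1 ss1 c2 h2 ss2)
    then show ?case using stepN by (meson rtranclp.rtrancl_into_rtrancl)
  qed
  show thesis
  proof (rule that[OF nc size])
    fix x :: "'a list" and h ss
    assume "(conf_step x)\<^sup>*\<^sup>* (P, 0, stacks 4 (\<lambda>_. 0)) (Skip, h, ss)"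
    then have "(step N x)\<^sup>*\<^sup>* (init_conf 4 N) (f Skip, h, ss)" using reach by blast
    then obtain cs where "finite_path 4 N x cs" "last cs = (f Skip, h, ss)"
      using finite_path_iff_reachable by blast
    then show "\<exists>cs. accepting_path 4 N x cs"
      by (auto simp: accepting_path_def N_def)
  next
    fix x :: "'a list" and h ss
    assume "(conf_step x)\<^sup>*\<^sup>* (P, 0, stacks 4 (\<lambda>_. 0)) (Fail, h, ss)"
    then have "(step N x)\<^sup>*\<^sup>* (init_conf 4 N) (f Fail, h, ss)" using reach by blast
    with det show "all_paths_rejecting 4 N x"
      by (rule all_paths_rejecting_if_deterministic) (simp_all add: N_def)
  qed
qed

section \<open>Program fragments\<close>

fun incs :: "nat \<Rightarrow> nat \<Rightarrow> 'a com" where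
  "incs 0 r = Skip"
| "incs (Suc n) r = Inc r ;; incs n r"

fun decs :: "nat \<Rightarrow> nat \<Rightarrow> 'a com" where
  "decs 0 r = Skip"
| "decs (Suc n) r = Dec r ;; decs n r"

definition transfer :: "nat \<Rightarrow> nat \<Rightarrow> nat \<Rightarrow> 'a com" where
  "transfer K a b = While a (Dec a ;; incs K b)"

text \<open>The second target \<open>c\<close> keeps the old value of \<open>a\<close>, so a later
  \<open>transfer\<close> can restore it; this is how a register is read without losing it.\<close>

definition transfer2 :: "nat \<Rightarrow> nat \<Rightarrow> nat \<Rightarrow> nat \<Rightarrow> 'a com" where
  "transfer2 K a b c = While a (Dec a ;; incs K b ;; Inc c)"

lemma wp_incs [simp]: "wp x (incs n r) Q (h, v) \<longleftrightarrow> Q (h, v(r := v r + n))"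
  by (induction n arbitrary: v) simp_all

lemma wp_decs: "n \<le> v r \<Longrightarrow> wp x (decs n r) Q (h, v) \<longleftrightarrow> Q (h, v(r := v r - n))"
  by (induction n arbitrary: v) simp_all

lemma wp_transfer [simp]:
  assumes "a \<noteq> b"
  shows "wp x (transfer K a b) Q (h, v) \<longleftrightarrow> Q (h, v(a := 0, b := v b + K * v a))"
proof (induction "v a" arbitrary: v)
  case 0
  then have "v(a := 0, b := v b + K * v a) = v" by (auto simp: fun_eq_iff)
  moreover have "wp x (transfer K a b) Q (h, v) \<longleftrightarrow> Q (h, v)"
    using 0 by (simp add: transfer_def wp_While_unfold)
  ultimately show ?case by metis
next
  case (Suc n)
  let ?w = "v(a := n, b := v b + K)"
  from Suc have a: "v a = Suc n" by simp
  have "wp x (transfer K a b) Q (h, v) \<longleftrightarrow> wp x (transfer K a b) Q (h, ?w)"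
    using assms a by (simp add: transfer_def wp_While_unfold[where v = v])
  also have "\<dots> \<longleftrightarrow> Q (h, ?w(a := 0, b := ?w b + K * ?w a))"
    using Suc.hyps(1)[of ?w] assms by simp
  also have "?w(a := 0, b := ?w b + K * ?w a) = v(a := 0, b := v b + K * v a)"
    using assms a by (auto simp: fun_eq_iff)
  finally show ?case .
qed

lemma wp_transfer2 [simp]:
  assumes "a \<noteq> b" "a \<noteq> c" "b \<noteq> c"
  shows "wp x (transfer2 K a b c) Q (h, v) \<longleftrightarrow>
    Q (h, v(a := 0, b := v b + K * v a, c := v c + v a))"
proof (induction "v a" arbitrary: v)
  case 0
  then have "v(a := 0, b := v b + K * v a, c := v c + v a) = v" by (auto simp: fun_eq_iff)
  moreover have "wp x (transfer2 K a b c) Q (h, v) \<longleftrightarrow> Q (h, v)"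
    using 0 by (simp add: transfer2_def wp_While_unfold)
  ultimately show ?case by metis
next
  case (Suc n)
  let ?w = "v(a := n, b := v b + K, c := Suc (v c))"
  from Suc have a: "v a = Suc n" by simp
  have "wp x (transfer2 K a b c) Q (h, v) \<longleftrightarrow> wp x (transfer2 K a b c) Q (h, ?w)"
    using assms a by (simp add: transfer2_def wp_While_unfold[where v = v])
  also have "\<dots> \<longleftrightarrow> Q (h, ?w(a := 0, b := ?w b + K * ?w a, c := ?w c + ?w a))"
    using Suc.hyps(1)[of ?w] assms by simp
  also have "?w(a := 0, b := ?w b + K * ?w a, c := ?w c + ?w a)
      = v(a := 0, b := v b + K * v a, c := v c + v a)"
    using assms a by (auto simp: fun_eq_iff)
  finally show ?case .
qed

lemma csize_incs [simp]: "csize (incs n r) = 2 * n + 1"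
  by (induction n) simp_all

lemma csize_decs [simp]: "csize (decs n r) = 2 * n + 1"
  by (induction n) simp_all

lemma csize_transfer [simp]: "csize (transfer K a b) = 2 * K + 5"
  by (simp add: transfer_def)

lemma csize_transfer2 [simp]: "csize (transfer2 K a b c) = 2 * K + 7"
  by (simp add: transfer2_def)

lemma regs_incs: "regs (incs n r) \<subseteq> {r}"
  by (induction n) auto

lemma regs_decs: "regs (decs n r) \<subseteq> {r}"
  by (induction n) auto

lemma regs_transfer: "regs (transfer K a b) \<subseteq> {a, b}"
  using regs_incs[of K b] by (auto simp: transfer_def)

lemma regs_transfer2: "regs (transfer2 K a b c) \<subseteq> {a, b, c}"
  using regs_incs[of K b] by (auto simp: transfer2_def)

lemma exec_eq_wp: "exec x c s t \<longleftrightarrow> wp x c (\<lambda>u. u = t) s"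
  unfolding wp_def by blast

section \<open>Goedel numbering of the registers\<close>

definition nth_prime :: "nat \<Rightarrow> nat" where
  "nth_prime = enumerate {p. prime p}"

lemma prime_nth_prime: "prime (nth_prime r)"
  using enumerate_in_set[OF primes_infinite, of r] by (simp add: nth_prime_def)

lemma nth_prime_pos [simp]: "0 < nth_prime r"
  by (rule prime_gt_0_nat[OF prime_nth_prime])

lemma nth_prime_eq_iff: "nth_prime r = nth_prime s \<longleftrightarrow> r = s"
  using strict_mono_eq[OF strict_mono_enumerate[OF primes_infinite]] by (simp add: nth_prime_def)

definition goedel_number :: "nat \<Rightarrow> (nat \<Rightarrow> nat) \<Rightarrow> nat" where
  "goedel_number J v = (\<Prod>r<J. nth_prime r ^ v r)"

lemma goedel_number_Suc:
  assumes "r < J"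
  shows "goedel_number J (v(r := Suc (v r))) = nth_prime r * goedel_number J v"
proof -
  have "(\<Prod>s\<in>{..<J} - {r}. nth_prime s ^ (v(r := Suc (v r))) s)
      = (\<Prod>s\<in>{..<J} - {r}. nth_prime s ^ v s)"
    by (rule prod.cong) auto
  with assms show ?thesis
    unfolding goedel_number_def by (simp add: prod.remove[of "{..<J}" r] mult.assoc)
qed

text \<open>By unique factorisation, the zero test of a register becomes a divisibility
  test.\<close>

lemma nth_prime_dvd_goedel_number:
  assumes "r < J"
  shows "nth_prime r dvd goedel_number J v \<longleftrightarrow> v r \<noteq> 0"
proof
  assume "nth_prime r dvd goedel_number J v"
  then obtain s where s: "s < J" "nth_prime r dvd nth_prime s ^ v s"
    unfolding goedel_number_def using prime_nth_prime[of r] by (auto simp: prime_dvd_prod_iff)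
  then have "nth_prime r dvd nth_prime s"
    using prime_nth_prime[of r] prime_dvd_power by blast
  then have "r = s"
    using prime_nth_prime primes_dvd_imp_eq nth_prime_eq_iff by blast
  show "v r \<noteq> 0"
  proof
    assume "v r = 0"
    with s(2) \<open>r = s\<close> have "nth_prime r dvd 1" by simp
    then show False using prime_nth_prime[of r] by (simp add: prime_nat_iff)
  qed
next
  assume "v r \<noteq> 0"
  then have "v = v(r := Suc (v r - 1), r := Suc ((v(r := v r - 1)) r))" by auto
  then have "goedel_number J v = nth_prime r * goedel_number J (v(r := v r - 1))"
    using goedel_number_Suc[OF assms, of "v(r := v r - 1)"] \<open>v r \<noteq> 0\<close> by simp
  then show "nth_prime r dvd goedel_number J v" by simp
qed

lemma goedel_number_pred:
  assumes "r < J" "v r \<noteq> 0"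
  shows "goedel_number J v = nth_prime r * goedel_number J (v(r := v r - 1))"
  using goedel_number_Suc[OF assms(1), of "v(r := v r - 1)"] assms(2) by simp

definition multiply :: "nat \<Rightarrow> 'a com" where
  "multiply p = transfer p 0 1 ;; transfer 1 1 0"

text \<open>Exact division only: the subtraction of \<open>p\<close> gets stuck if counter 0 is not
  a multiple of \<open>p\<close>.\<close>

definition divide :: "nat \<Rightarrow> 'a com" where
  "divide p = While 0 (decs p 0 ;; Inc 1) ;; transfer 1 1 0"

text \<open>Moves \<open>j\<close> units from counter 0 to counter 1. Running short is recorded in
  counter 2, and then counter 0 is already empty.\<close>

fun shift :: "nat \<Rightarrow> 'a com" where
  "shift 0 = Skip"
| "shift (Suc j) = IfZero 0 (Inc 2) (Dec 0 ;; Inc 1 ;; shift j)"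

definition test_dvd :: "nat \<Rightarrow> 'a com" where
  "test_dvd p = While 0 (shift p) ;; IfZero 2 (Inc 3) (Dec 2) ;; transfer 1 1 0"

definition single :: "nat \<Rightarrow> nat \<Rightarrow> nat" where
  "single n = (\<lambda>_. 0)(0 := n)"

lemma wp_multiply: "wp x (multiply p) Q (h, single n) \<longleftrightarrow> Q (h, single (p * n))"
proof -
  have "(single n)(0 := 0, 1 := p * n, 1 := 0, 0 := p * n) = single (p * n)"
    by (auto simp: single_def fun_eq_iff)
  then show ?thesis by (simp add: multiply_def) (simp add: single_def)
qed

lemma wp_divide:
  assumes "p > 0"
  shows "wp x (divide p) Q (h, single (p * n)) \<longleftrightarrow> Q (h, single n)"
proof -
  have "wp x (While 0 (decs p 0 ;; Inc 1)) Q (h, v) \<longleftrightarrow> Q (h, v(0 := 0, 1 := v 1 + n))"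
    if "v 0 = p * n" for v Q
    using that
  proof (induction n arbitrary: v)
    case 0
    then have "v(0 := 0, 1 := v 1 + 0) = v" by (auto simp: fun_eq_iff)
    moreover have "wp x (While 0 (decs p 0 ;; Inc 1)) Q (h, v) \<longleftrightarrow> Q (h, v)"
      using 0 by (simp add: wp_While_unfold)
    ultimately show ?case by metis
  next
    case (Suc n)
    then have "wp x (While 0 (decs p 0 ;; Inc 1)) Q (h, v) \<longleftrightarrow>
        wp x (While 0 (decs p 0 ;; Inc 1)) Q (h, v(0 := p * n, 1 := Suc (v 1)))"
      using assms by (simp add: wp_While_unfold[where v = v] wp_decs)
    also have "\<dots> \<longleftrightarrow> Q (h, v(0 := p * n, 1 := Suc (v 1), 0 := 0,
        1 := (v(0 := p * n, 1 := Suc (v 1))) 1 + n))"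
      by (rule Suc.IH) simp
    also have "v(0 := p * n, 1 := Suc (v 1), 0 := 0, 1 := (v(0 := p * n, 1 := Suc (v 1))) 1 + n)
        = v(0 := 0, 1 := v 1 + Suc n)"
      by (auto simp: fun_eq_iff)
    finally show ?case .
  qed
  moreover have "(single (p * n))(0 := 0, 1 := n, 1 := 0, 0 := n) = single n"
    by (auto simp: single_def fun_eq_iff)
  ultimately show ?thesis
    by (simp add: divide_def single_def)
qed

lemma wp_shift:
  "wp x (shift j) Q (h, v) \<longleftrightarrow>
    (if j \<le> v 0 then Q (h, v(0 := v 0 - j, 1 := v 1 + j))
     else Q (h, v(0 := 0, 1 := v 1 + v 0, 2 := Suc (v 2))))"
proof (induction j arbitrary: v)
  case 0
  have "v(0 := v 0 - 0, 1 := v 1 + 0) = v" by (auto simp: fun_eq_iff)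
  then show ?case by (metis le0 shift.simps(1) wp_simps(1))
next
  case (Suc j)
  show ?case
  proof (cases "v 0 = 0")
    case True
    then have "v(0 := 0, 1 := v 1 + v 0, 2 := Suc (v 2)) = v(2 := Suc (v 2))"
      by (auto simp: fun_eq_iff)
    moreover have "wp x (shift (Suc j)) Q (h, v) \<longleftrightarrow> Q (h, v(2 := Suc (v 2)))"
      using True by simp
    moreover have "\<not> Suc j \<le> v 0" using True by simp
    ultimately show ?thesis by (simp only: if_False)
  next
    case False
    let ?w = "v(0 := v 0 - 1, 1 := Suc (v 1))"
    have "?w(0 := ?w 0 - j, 1 := ?w 1 + j) = v(0 := v 0 - Suc j, 1 := v 1 + Suc j)"
      "?w(0 := 0, 1 := ?w 1 + ?w 0, 2 := Suc (?w 2)) = v(0 := 0, 1 := v 1 + v 0, 2 := Suc (v 2))"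
      using False by (auto simp: fun_eq_iff)
    moreover have "wp x (shift (Suc j)) Q (h, v) \<longleftrightarrow> wp x (shift j) Q (h, ?w)"
      using False by simp
    moreover have "j \<le> ?w 0 \<longleftrightarrow> Suc j \<le> v 0" using False by auto
    ultimately show ?thesis unfolding Suc.IH[of ?w] by presburger
  qed
qed

text \<open>Only the last round of \<open>shift p\<close> can fall short, since it empties counter 0
  and ends the loop. Hence counter 2 is at most 1 and says whether the remainder is nonzero, while
  counter 1 has saved the whole number.\<close>

lemma wp_test_dvd:
  assumes "p > 0"
  shows "wp x (test_dvd p) Q (h, single n) \<longleftrightarrow>
    Q (h, (single n)(3 := if p dvd n then 1 else 0))"
proof -
  have loop: "wp x (While 0 (shift p)) Q (h, v) \<longleftrightarrow>
      Q (h, v(0 := 0, 1 := v 1 + v 0, 2 := if p dvd v 0 then 0 else 1))"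
    if "v 2 = 0" for v Q
    using that
  proof (induction "v 0" arbitrary: v rule: less_induct)
    case less
    consider "v 0 = 0" | "0 < v 0" "v 0 < p" | "p \<le> v 0" by linarith
    then show ?case
    proof cases
      case 1
      then have "v(0 := 0, 1 := v 1, 2 := 0) = v" using less.prems by (auto simp: fun_eq_iff)
      with 1 show ?thesis by (simp add: wp_While_unfold)
    next
      case 2
      then show ?thesis
        using less.prems by (simp add: wp_While_unfold wp_shift nat_dvd_not_less)
    next
      case 3
      let ?w = "v(0 := v 0 - p, 1 := v 1 + p)"
      have "wp x (While 0 (shift p)) Q (h, v) \<longleftrightarrow> wp x (While 0 (shift p)) Q (h, ?w)"
        using 3 assms by (simp add: wp_While_unfold[where v = v] wp_shift)
      also have "\<dots> \<longleftrightarrow> Q (h, ?w(0 := 0, 1 := ?w 1 + ?w 0, 2 := if p dvd ?w 0 then 0 else 1))"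
        by (rule less.hyps) (use 3 assms less.prems in auto)
      also have "?w(0 := 0, 1 := ?w 1 + ?w 0, 2 := if p dvd ?w 0 then 0 else 1)
          = v(0 := 0, 1 := v 1 + v 0, 2 := if p dvd v 0 then 0 else 1)"
        using 3 by (auto simp: fun_eq_iff dvd_minus_self)
      finally show ?thesis .
    qed
  qed
  show ?thesis
    by (simp add: test_dvd_def single_def loop) (auto simp: fun_eq_iff fun_upd_def intro!: arg_cong[where f = "\<lambda>w. Q (h, w)"])
qed

text \<open>After a test, counter 3 is 1 exactly when the simulated register is nonzero. Each
  nonzero branch starts with \<open>Dec 3\<close>, so that counters 1 to 3 are zero again whenever a
  simulated instruction begins.\<close>

fun goedel :: "'a com \<Rightarrow> 'a com" where
  "goedel (Inc r) = multiply (nth_prime r)"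
| "goedel (Dec r) = divide (nth_prime r)"
| "goedel (c ;; c') = goedel c ;; goedel c'"
| "goedel (IfZero r c c') =
     test_dvd (nth_prime r) ;; IfZero 3 (goedel c) (Dec 3 ;; goedel c')"
| "goedel (IfTape P c c') = IfTape P (goedel c) (goedel c')"
| "goedel (While r c) =
     test_dvd (nth_prime r) ;; While 3 (Dec 3 ;; goedel c ;; test_dvd (nth_prime r))"
| "goedel c = c"

lemma single_3 [simp]: "single n 3 = 0" "(single n)(3 := 0) = single n"
  by (auto simp: single_def)

text \<open>\<open>Inc\<close> multiplies and \<open>Dec\<close> divides by a prime; the division is
  exact because an execution of \<open>Dec\<close> presupposes a nonzero register.\<close>

lemma exec_goedel:
  "exec x c s t \<Longrightarrow> regs c \<subseteq> {..<J} \<Longrightarrow>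
   exec x (goedel c) (fst s, single (goedel_number J (snd s)))
     (fst t, single (goedel_number J (snd t)))"
proof (induction rule: exec.induct)
  case (Inc r h v)
  then show ?case by (simp add: exec_eq_wp wp_multiply goedel_number_Suc[unfolded fun_upd_def])
next
  case (Dec v r h)
  then show ?case by (simp add: exec_eq_wp goedel_number_pred[unfolded fun_upd_def One_nat_def] wp_divide)
next
  case (Seq c s t c' u)
  then show ?case by (auto intro: exec.Seq)
next
  case (IfZeroT v r c h t c')
  then show ?case
    by (simp add: exec_eq_wp wp_test_dvd nth_prime_dvd_goedel_number)
next
  case (IfZeroF v r c' h t c)
  then show ?case
    by (simp add: exec_eq_wp wp_test_dvd nth_prime_dvd_goedel_number)
next
  case (WhileF v r c h)
  then show ?case
    by (simp add: exec_eq_wp wp_test_dvd nth_prime_dvd_goedel_number wp_While_unfold)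
next
  case (WhileT v r c h t u)
  from WhileT have step: "exec x (goedel c) (h, single (goedel_number J v))
      (fst t, single (goedel_number J (snd t)))" by simp
  from WhileT show ?case
    by (simp add: exec_eq_wp wp_test_dvd nth_prime_dvd_goedel_number
        wp_While_unfold[where h = h] wp_exec[OF step])
qed (auto simp: exec_eq_wp)

lemma regs_multiply: "regs (multiply p) \<subseteq> {..<4}"
  using regs_transfer[of p 0 1] regs_transfer[of 1 1 0] by (fastforce simp: multiply_def)

lemma regs_divide: "regs (divide p) \<subseteq> {..<4}"
  using regs_decs[of p 0] regs_transfer[of 1 1 0] by (fastforce simp: divide_def)

lemma regs_test_dvd: "regs (test_dvd p) \<subseteq> {..<4}"
proof -
  have "regs (shift p) \<subseteq> {..<4}" by (induction p) auto
  then show ?thesis using regs_transfer[of 1 1 0] by (fastforce simp: test_dvd_def)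
qed

lemma regs_goedel: "regs (goedel c) \<subseteq> {..<4}"
  by (induction c) (use regs_multiply regs_divide regs_test_dvd in \<open>simp_all add: subset_iff\<close>)

lemma csize_pos: "0 < csize c"
  by (induction c) auto

lemma csize_test_dvd: "csize (test_dvd p) = 7 * p + 15"
proof -
  have "csize (shift p) = 7 * p + 1" by (induction p) auto
  then show ?thesis by (simp add: test_dvd_def)
qed

text \<open>The loop case determines the factor: it contains two divisibility tests of size
  \<open>7 * p + 15\<close> each.\<close>

lemma csize_goedel:
  assumes "\<And>r. r < J \<Longrightarrow> nth_prime r \<le> B" and "regs c \<subseteq> {..<J}"
  shows "csize (goedel c) \<le> (14 * B + 40) * csize c"
  using assms(2)
proof (induction c)
  case (Inc r)
  then show ?case using assms(1)[of r] by (simp add: multiply_def)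
next
  case (Dec r)
  then show ?case using assms(1)[of r] by (simp add: divide_def)
next
  case (IfZero r c c')
  then show ?case using assms(1)[of r] by (simp add: csize_test_dvd algebra_simps)
next
  case (While r c)
  then show ?case using assms(1)[of r] by (simp add: csize_test_dvd algebra_simps)
qed (simp_all add: algebra_simps)

text \<open>The order of quantifiers is the point: \<open>K\<close> depends on the number of
  registers only, so the automaton is linear in the size of the program.\<close>

lemma four_counters_suffice:
  fixes J :: nat
  obtains K :: nat where
    "\<And>(P :: 'a com) R. regs P \<subseteq> {..<J} \<Longrightarrow> R < J \<Longrightarrow>
       \<exists>N :: 'a ncta. is_ncta 4 N \<and> card (states N) \<le> K * csize P \<and>
         (\<forall>x h v. exec x P (0, \<lambda>_. 0) (h, v) \<longrightarrow>
            (if v R = 0 then \<exists>cs. accepting_path 4 N x cs else all_paths_rejecting 4 N x))"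
proof -
  \<comment> \<open>A crude common bound for the first \<open>J\<close> primes.\<close>
  define B where "B = (\<Sum>r<J. nth_prime r)"
  have B: "nth_prime r \<le> B" if "r < J" for r
    unfolding B_def by (rule member_le_sum) (use that in auto)
  show thesis
  proof (rule that[of "(14 * B + 40) + 7 * B + 40"])
    fix P :: "'a com" and R
    assume P: "regs P \<subseteq> {..<J}" and R: "R < J"
    \<comment> \<open>\<open>Inc 0\<close> produces the number 1, which encodes the store with all
      registers zero. The final test reads the verdict from register \<open>R\<close>.\<close>
    let ?A = "Inc 0 ;; goedel P ;; test_dvd (nth_prime R)"
    let ?P = "?A ;; IfZero 3 Skip Fail"
    show "\<exists>N :: 'a ncta. is_ncta 4 N \<and>
        card (states N) \<le> (14 * B + 40 + 7 * B + 40) * csize P \<and>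
        (\<forall>x h v. exec x P (0, \<lambda>_. 0) (h, v) \<longrightarrow>
           (if v R = 0 then \<exists>cs. accepting_path 4 N x cs else all_paths_rejecting 4 N x))"
    proof (rule compile[of ?P])
      fix N :: "'a ncta"
      assume N: "is_ncta 4 N" "card (states N) \<le> csize ?P + 2"
        "\<And>x h ss. (conf_step x)\<^sup>*\<^sup>* (?P, 0, stacks 4 (\<lambda>_. 0)) (Skip, h, ss) \<Longrightarrow>
           \<exists>cs. accepting_path 4 N x cs"
        "\<And>x h ss. (conf_step x)\<^sup>*\<^sup>* (?P, 0, stacks 4 (\<lambda>_. 0)) (Fail, h, ss) \<Longrightarrow>
           all_paths_rejecting 4 N x"
      have "csize ?P + 2 \<le> (14 * B + 40) * csize P + (7 * B + 40) * 1"
        using csize_goedel[OF B P] B[OF R] by (simp add: csize_test_dvd)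
      also have "\<dots> \<le> (14 * B + 40) * csize P + (7 * B + 40) * csize P"
        using csize_pos[of P] by (intro add_mono mult_le_mono) auto
      finally have size: "card (states N) \<le> (14 * B + 40 + 7 * B + 40) * csize P"
        using N(2) by (simp add: algebra_simps)
      have "if v R = 0 then \<exists>cs. accepting_path 4 N x cs else all_paths_rejecting 4 N x"
        if ex: "exec x P (0, \<lambda>_. 0) (h, v)" for x h v
      proof -
        let ?w = "(single (goedel_number J v))(3 := if v R = 0 then 0 else 1)"
        have one: "(\<lambda>_. 0)(0 := Suc 0) = single (goedel_number J (\<lambda>_. 0))"
          by (simp add: goedel_number_def single_def)
        have "exec x (goedel P) (0, single (goedel_number J (\<lambda>_. 0))) (h, single (goedel_number J v))"
          using exec_goedel[OF ex P] by simp
        then have "exec x ?A (0, \<lambda>_. 0) (h, ?w)"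
          using R by (simp add: exec_eq_wp[where c = ?A] one wp_exec wp_test_dvd
              nth_prime_dvd_goedel_number)
        moreover have "regs ?A \<subseteq> {..<4}"
          using regs_goedel[of P] regs_test_dvd by auto
        ultimately have "(conf_step x)\<^sup>*\<^sup>* (?A, 0, stacks 4 (\<lambda>_. 0)) (Skip, h, stacks 4 ?w)"
          using exec_conf_steps[of x ?A "(0, \<lambda>_. 0)" "(h, ?w)"] by (simp only: fst_conv snd_conv)
        then have "(conf_step x)\<^sup>*\<^sup>* (?P, 0, stacks 4 (\<lambda>_. 0)) (Skip ;; IfZero 3 Skip Fail, h, stacks 4 ?w)"
          by (rule conf_step_Seq)
        also have "conf_step x (Skip ;; IfZero 3 Skip Fail, h, stacks 4 ?w)
            (IfZero 3 Skip Fail, h, stacks 4 ?w)"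
          by (rule conf_step_Skip_Seq)
        also have "conf_step x (IfZero 3 Skip Fail, h, stacks 4 ?w)
            (if v R = 0 then Skip else Fail, h, stacks 4 ?w)"
          by (auto simp: conf_step_def map_hd_stacks tops_nth map2_keeps)
        finally show ?thesis using N(3,4)[of x h "stacks 4 ?w"] by presburger
      qed
      with N(1) size show ?thesis by blast
    qed
  qed
qed

section \<open>Program fragments for the search\<close>

definition clear :: "nat \<Rightarrow> 'a com" where
  "clear r = While r (Dec r)"

fun clears :: "nat \<Rightarrow> nat \<Rightarrow> 'a com" where
  "clears r 0 = Skip"
| "clears r (Suc n) = clear r ;; clears (Suc r) n"

text \<open>A jump table on the value of a register. The register is zero when a branch starts, so
  the branch can write a new value by increments alone.\<close>

fun select :: "nat \<Rightarrow> nat \<Rightarrow> (nat \<Rightarrow> 'a com) \<Rightarrow> 'a com" where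
  "select r 0 f = Skip"
| "select r (Suc n) f = IfZero r (f 0) (Dec r ;; select r n (\<lambda>i. f (Suc i)))"

text \<open>The zero pattern of the counters becomes a parameter of the program text. The price is
  \<open>2 ^ n\<close> copies of the continuation, constant for a fixed number of counters.\<close>

fun with_tops :: "nat \<Rightarrow> nat \<Rightarrow> (stack_symbol list \<Rightarrow> 'a com) \<Rightarrow> 'a com" where
  "with_tops r 0 f = f []"
| "with_tops r (Suc n) f =
     IfZero r (with_tops (Suc r) n (\<lambda>ts. f (Bottom # ts))) (with_tops (Suc r) n (\<lambda>ts. f (One # ts)))"

fun op_prog :: "nat \<Rightarrow> stack_op \<Rightarrow> 'a com" where
  "op_prog r Push = Inc r"
| "op_prog r Pop = Dec r"
| "op_prog r Keep = Skip"

fun ops_prog :: "nat \<Rightarrow> stack_op list \<Rightarrow> 'a com" where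
  "ops_prog r [] = Skip"
| "ops_prog r (opr # ops) = op_prog r opr ;; ops_prog (Suc r) ops"

text \<open>Register \<open>r\<close> serves as the loop flag; it stays 1 until the left endmarker
  is seen.\<close>

definition rewind :: "nat \<Rightarrow> 'a com" where
  "rewind r = Inc r ;; While r (IfTape (\<lambda>a. a = LeftEnd) (Dec r) (Move MoveLeft))"

lemma wp_clear [simp]: "wp x (clear r) Q (h, v) \<longleftrightarrow> Q (h, v(r := 0))"
proof (induction "v r" arbitrary: v)
  case 0
  then have "v(r := 0) = v" by (auto simp: fun_eq_iff)
  moreover have "wp x (clear r) Q (h, v) \<longleftrightarrow> Q (h, v)"
    using 0 by (simp add: clear_def wp_While_unfold)
  ultimately show ?case by metis
next
  case (Suc n)
  from Suc have "v r = Suc n" by simp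
  then have "wp x (clear r) Q (h, v) \<longleftrightarrow> wp x (clear r) Q (h, v(r := n))"
    by (simp add: clear_def wp_While_unfold[where v = v])
  with Suc.hyps(1)[of "v(r := n)"] show ?case by simp
qed

lemma wp_clears:
  "wp x (clears r n) Q (h, v) \<longleftrightarrow> Q (h, \<lambda>s. if r \<le> s \<and> s < r + n then 0 else v s)"
proof (induction n arbitrary: r v)
  case (Suc n)
  have "(\<lambda>s. if Suc r \<le> s \<and> s < Suc r + n then 0 else (v(r := 0)) s)
      = (\<lambda>s. if r \<le> s \<and> s < r + Suc n then 0 else v s)"
    by (auto simp: fun_eq_iff)
  then show ?case by (simp only: clears.simps wp_simps wp_clear Suc.IH)
next
  case 0
  have "(\<lambda>s. if r \<le> s \<and> s < r + 0 then 0 else v s) = v" by (auto simp: fun_eq_iff)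
  then show ?case by (simp only: clears.simps wp_simps)
qed

lemma wp_select:
  "v r < n \<Longrightarrow> wp x (select r n f) Q (h, v) \<longleftrightarrow> wp x (f (v r)) Q (h, v(r := 0))"
proof (induction n arbitrary: f v)
  case (Suc n)
  show ?case
  proof (cases "v r = 0")
    case True
    then have "v(r := 0) = v" by (auto simp: fun_eq_iff)
    with True show ?thesis by (simp only: select.simps wp_simps if_True simp_thms)
  next
    case False
    let ?w = "v(r := v r - 1)"
    have "wp x (select r (Suc n) f) Q (h, v) \<longleftrightarrow> wp x (select r n (\<lambda>i. f (Suc i))) Q (h, ?w)"
      using False by simp
    also have "\<dots> \<longleftrightarrow> wp x (f (Suc (?w r))) Q (h, ?w(r := 0))"
      by (rule Suc.IH) (use Suc.prems False in auto)
    also have "?w(r := 0) = v(r := 0)" by simp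
    also have "Suc (?w r) = v r" using False by simp
    finally show ?thesis .
  qed
qed simp

lemma wp_with_tops:
  "wp x (with_tops r n f) Q (h, v) \<longleftrightarrow>
     wp x (f (map (\<lambda>i. if v i = 0 then Bottom else One) [r..<r + n])) Q (h, v)"
proof (induction n arbitrary: r f)
  case (Suc n)
  have "[r..<r + Suc n] = r # [Suc r..<Suc r + n]" by (simp add: upt_conv_Cons)
  then show ?case by (simp del: upt_Suc add: Suc.IH)
qed simp

lemma wp_ops_prog:
  "(\<And>i. i < length ops \<Longrightarrow> v (r + i) = 0 \<Longrightarrow> ops ! i \<noteq> Pop) \<Longrightarrow>
   wp x (ops_prog r ops) Q (h, v) \<longleftrightarrow>
     Q (h, \<lambda>s. if r \<le> s \<and> s < r + length ops then op_val (ops ! (s - r)) (v s) else v s)"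
proof (induction ops arbitrary: r v)
  case (Cons opr ops)
  let ?w = "v(r := op_val opr (v r))"
  have 0: "v r = 0 \<Longrightarrow> opr \<noteq> Pop" using Cons.prems[of 0] by simp
  have eq: "(\<lambda>s. if Suc r \<le> s \<and> s < Suc r + length ops then op_val (ops ! (s - Suc r)) (?w s) else ?w s)
      = (\<lambda>s. if r \<le> s \<and> s < r + length (opr # ops) then op_val ((opr # ops) ! (s - r)) (v s) else v s)"
    by (auto simp: fun_eq_iff nth_Cons' Suc_diff_Suc)
  have "v(r := v r) = v" by simp
  then have "wp x (ops_prog r (opr # ops)) Q (h, v) \<longleftrightarrow> wp x (ops_prog (Suc r) ops) Q (h, ?w)"
    using 0 by (cases opr) auto
  also have "\<dots> \<longleftrightarrow> Q (h, \<lambda>s. if Suc r \<le> s \<and> s < Suc r + length ops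
      then op_val (ops ! (s - Suc r)) (?w s) else ?w s)"
    by (rule Cons.IH) (use Cons.prems[of "Suc _"] in auto)
  finally show ?case unfolding eq .
next
  case Nil
  have "(\<lambda>s. if r \<le> s \<and> s < r + length ([] :: stack_op list) then op_val ([] ! (s - r)) (v s) else v s) = v"
    by (auto simp: fun_eq_iff)
  then show ?case by (simp only: ops_prog.simps wp_simps)
qed

lemma tape_at_eq_LeftEnd: "tape_at x h = LeftEnd \<longleftrightarrow> h = 0"
  by (simp add: tape_at_def)

lemma wp_rewind:
  assumes "v r = 0"
  shows "wp x (rewind r) Q (h, v) \<longleftrightarrow> Q (0, v)"
proof -
  let ?W = "While r (IfTape (\<lambda>a. a = LeftEnd) (Dec r) (Move MoveLeft))"
  have clamp: "clamp MoveLeft a = MoveLeft" if "a \<noteq> LeftEnd" for a :: "'a tape_symbol"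
    using that by (cases a) auto
  define w where "w = v(r := 1)"
  have w: "w r = 1" "w(r := 0) = v"
    using assms by (auto simp: w_def fun_eq_iff)
  have "wp x ?W Q (h, w) \<longleftrightarrow> Q (0, v)"
  proof (induction h)
    case 0
    show ?case
      by (simp add: wp_While_unfold[where v = w] tape_at_eq_LeftEnd w)
        (simp add: wp_While_unfold[where v = v] assms)
  next
    case (Suc h)
    then show ?case
      by (simp add: wp_While_unfold[where h = "Suc h"] tape_at_eq_LeftEnd clamp w)
  qed
  then show ?thesis using assms by (simp add: rewind_def w_def)
qed

section \<open>Sizes and registers of the fragments\<close>

lemma csize_clear [simp]: "csize (clear r) = 4"
  by (simp add: clear_def)

lemma csize_clears [simp]: "csize (clears r n) = 4 * n + 1"
  by (induction n arbitrary: r) simp_all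

lemma csize_select:
  "(\<And>i. i < n \<Longrightarrow> csize (f i) \<le> B) \<Longrightarrow> csize (select r n f) \<le> n * (B + 3) + 1"
proof (induction n arbitrary: f)
  case (Suc n)
  from Suc.prems[of 0] Suc.IH[of "\<lambda>i. f (Suc i)"] Suc.prems[of "Suc _"] show ?case by simp
qed simp

lemma csize_with_tops:
  "(\<And>ts. csize (f ts) \<le> B) \<Longrightarrow> csize (with_tops r n f) + 1 \<le> 2 ^ n * (B + 1)"
proof (induction n arbitrary: r f)
  case (Suc n)
  from Suc.IH[of "\<lambda>ts. f (Bottom # ts)" "Suc r"] Suc.IH[of "\<lambda>ts. f (One # ts)" "Suc r"]
    Suc.prems show ?case by (simp add: algebra_simps)
qed simp

lemma csize_ops_prog: "csize (ops_prog r ops) \<le> 2 * length ops + 1"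
proof (induction ops arbitrary: r)
  case (Cons opr ops)
  from Cons[of "Suc r"] show ?case by (cases opr) auto
qed simp

lemma csize_rewind [simp]: "csize (rewind r) = 9"
  by (simp add: rewind_def)

lemma regs_clears: "regs (clears r n) \<subseteq> {r..<r + n}"
proof (induction n arbitrary: r)
  case (Suc n)
  then show ?case using Suc[of "Suc r"] by (fastforce simp: clear_def)
qed simp

lemma regs_select: "(\<And>i. i < n \<Longrightarrow> regs (f i) \<subseteq> A) \<Longrightarrow> r \<in> A \<Longrightarrow> regs (select r n f) \<subseteq> A"
  by (induction n arbitrary: f) auto

lemma regs_with_tops:
  "(\<And>ts. regs (f ts) \<subseteq> A) \<Longrightarrow> {r..<r + n} \<subseteq> A \<Longrightarrow> regs (with_tops r n f) \<subseteq> A"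
proof (induction n arbitrary: r f)
  case (Suc n)
  have sub: "{Suc r..<Suc r + n} \<subseteq> A" using Suc.prems(2) by auto
  have "regs (with_tops (Suc r) n (\<lambda>ts. f (Bottom # ts))) \<subseteq> A"
    "regs (with_tops (Suc r) n (\<lambda>ts. f (One # ts))) \<subseteq> A"
    by (rule Suc.IH[OF _ sub], rule Suc.prems)+
  with Suc.prems(2) show ?case by auto
qed simp

lemma regs_ops_prog: "regs (ops_prog r ops) \<subseteq> {r..<r + length ops}"
proof (induction ops arbitrary: r)
  case (Cons opr ops)
  then show ?case using Cons[of "Suc r"] by (cases opr) fastforce+
qed simp

section \<open>Bijective numeration of choice sequences\<close>

lemma pred_div_less: "n \<noteq> 0 \<Longrightarrow> (n - 1) div b < (n :: nat)"
  by (meson diff_less div_le_dividend le_less_trans less_one not_gr_zero)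

text \<open>Bijective base \<open>b\<close>, least significant digit first, with digit
  \<open>d\<close> weighing \<open>d + 1\<close>. In contrast to ordinary numerals there are no
  leading zeros to identify different lists, so every choice sequence has exactly one number; and
  one division yields the first choice.\<close>

function digits :: "nat \<Rightarrow> nat \<Rightarrow> nat list" where
  "digits b n = (if n = 0 then [] else (n - 1) mod b # digits b ((n - 1) div b))"
  by auto
termination by (relation "measure snd") (use pred_div_less in auto)

declare digits.simps [simp del]

fun undigits :: "nat \<Rightarrow> nat list \<Rightarrow> nat" where
  "undigits b [] = 0"
| "undigits b (d # ds) = b * undigits b ds + d + 1"

lemma digits_undigits: "set ds \<subseteq> {..<b} \<Longrightarrow> digits b (undigits b ds) = ds"
  by (induction ds) (auto simp: digits.simps)

lemma undigits_digits: "undigits b (digits b n) = n"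
proof (induction n rule: less_induct)
  case (less n)
  show ?case
  proof (cases "n = 0")
    case False
    then have "(n - 1) div b < n" by (rule pred_div_less)
    with less False show ?thesis by (simp add: digits.simps[of b n])
  qed (simp add: digits.simps)
qed

lemma set_digits: "b > 0 \<Longrightarrow> set (digits b n) \<subseteq> {..<b}"
proof (induction n rule: less_induct)
  case (less n)
  show ?case
  proof (cases "n = 0")
    case False
    then have "(n - 1) div b < n" by (rule pred_div_less)
    with less False show ?thesis by (simp add: digits.simps[of b n])
  qed (simp add: digits.simps)
qed

lemma undigits_snoc_gt: "b > 0 \<Longrightarrow> undigits b ds < undigits b (ds @ [d])"
  by (induction ds) auto

text \<open>The appended digit is the most significant one and adds
  \<open>(d + 1) * b ^ length ds\<close>. Each digit weighs at least 1, so
  \<open>b ^ length ds\<close> is at most \<open>b * undigits b ds + 1\<close>.\<close>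

lemma undigits_snoc_le:
  assumes "d < b"
  shows "undigits b (ds @ [d]) \<le> undigits b ds + b * (b * undigits b ds + 1)"
proof (induction ds)
  case Nil
  then show ?case using assms by simp
next
  case (Cons e ds)
  let ?c = "undigits b ds"
  have "undigits b ((e # ds) @ [d]) \<le> b * (?c + b * (b * ?c + 1)) + e + 1"
    using Cons by simp
  also have "\<dots> \<le> undigits b (e # ds) + b * (b * undigits b (e # ds) + 1)"
    by (simp add: algebra_simps)
  finally show ?case .
qed

lemma undigits_take_le: "b > 0 \<Longrightarrow> undigits b (take n ds) \<le> undigits b ds"
proof (induction ds arbitrary: n)
  case (Cons d ds)
  then show ?case by (cases n) auto
qed simp

section \<open>Simulating a nondeterministic automaton along choice sequences\<close>

text \<open>The list \<open>qs\<close> gives states small names: the numbers in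
  \<open>states M\<close> can be large even if there are few of them, whereas positions fit a jump
  table of polynomial size.\<close>

locale source =
  fixes k :: nat and M :: "'a ncta" and qs :: "nat list"
  assumes ncta: "is_ncta k M" and set_qs: "set qs = states M"
begin

definition index :: "nat \<Rightarrow> nat" where
  "index q = (SOME i. i < length qs \<and> qs ! i = q)"

text \<open>All conceivable moves, independent of the configuration, so that one fixed base serves
  the whole run. A choice that is not a transition at the current configuration kills the
  run.\<close>

definition choices :: "(nat \<times> move \<times> stack_op list) list" where
  "choices = List.product qs (List.product [MoveLeft, Stay, MoveRight]
     (List.n_lists k [Push, Pop, Keep]))"

abbreviation base :: nat where
  "base \<equiv> length choices"

definition running :: "nat \<Rightarrow> bool" where
  "running i \<longleftrightarrow> i < length qs"

definition accepting :: "nat \<Rightarrow> bool" where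
  "accepting i \<longleftrightarrow> i < length qs \<and> qs ! i \<in> acc_states M"

text \<open>
  States are represented by their position in \<open>qs\<close>; the position \<open>length qs\<close> stands for a
  dead computation.  Accepting computations are prolonged by idling.
\<close>

definition choice_step :: "'a list \<Rightarrow> nat \<Rightarrow> nat \<times> nat \<times> (nat \<Rightarrow> nat) \<Rightarrow> nat \<times> nat \<times> (nat \<Rightarrow> nat)" where
  "choice_step x j s = (case s of (i, h, v) \<Rightarrow>
     if \<not> running i \<or> qs ! i \<in> rej_states M then (length qs, h, v)
     else if qs ! i \<in> acc_states M then (i, h, v)
     else (case choices ! j of (p, d, ops) \<Rightarrow>
       if (p, d, ops) \<in> trans M (qs ! i) (tape_at x h) (tops k v)
       then (index p, move_head d h, \<lambda>r. if r < k then op_val (ops ! r) (v r) else 0)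
       else (length qs, h, v)))"

definition start :: "nat \<times> nat \<times> (nat \<Rightarrow> nat)" where
  "start = (index (init_state M), 0, \<lambda>_. 0)"

definition run :: "'a list \<Rightarrow> nat list \<Rightarrow> nat \<times> nat \<times> (nat \<Rightarrow> nat) \<Rightarrow> nat \<times> nat \<times> (nat \<Rightarrow> nat)" where
  "run x js s = fold (choice_step x) js s"

definition proper :: "nat \<times> nat \<times> (nat \<Rightarrow> nat) \<Rightarrow> bool" where
  "proper s \<longleftrightarrow> fst s \<le> length qs \<and> (\<forall>r\<ge>k. snd (snd s) r = 0)"

definition conf_of :: "nat \<times> nat \<times> (nat \<Rightarrow> nat) \<Rightarrow> conf" where
  "conf_of s = (qs ! fst s, fst (snd s), stacks k (snd (snd s)))"

lemma index: "q \<in> states M \<Longrightarrow> index q < length qs \<and> qs ! index q = q"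
  unfolding index_def by (rule someI_ex) (simp add: set_qs flip: in_set_conv_nth)

lemma init_in_states: "init_state M \<in> states M"
  using ncta unfolding is_ncta_def by blast

lemma qs_nth: "i < length qs \<Longrightarrow> qs ! i \<in> states M"
  unfolding set_qs[symmetric] by (rule nth_mem)

lemma length_choices: "base = length qs * (3 * 3 ^ k)"
  by (simp add: choices_def length_n_lists numeral_3_eq_3)

lemma length_qs_pos: "0 < length qs"
  using init_in_states index by (cases qs) force+

lemma base_pos: "0 < base"
  using length_qs_pos by (simp add: length_choices)

lemma set_choices: "set choices = {(p, d, ops). p \<in> states M \<and> length ops = k}"
proof -
  have moves: "{MoveLeft, Stay, MoveRight} = UNIV"
  proof (intro set_eqI iffI)
    show "d \<in> {MoveLeft, Stay, MoveRight}" for d by (cases d) auto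
  qed simp
  have ops: "{Push, Pop, Keep} = UNIV"
  proof (intro set_eqI iffI)
    show "opr \<in> {Push, Pop, Keep}" for opr by (cases opr) auto
  qed simp
  have "set choices = states M \<times> {MoveLeft, Stay, MoveRight} \<times>
      {ops. length ops = k \<and> set ops \<subseteq> {Push, Pop, Keep}}"
    by (auto simp: choices_def set_n_lists set_qs)
  then show ?thesis unfolding moves ops by auto
qed

lemma choices_nth:
  assumes "j < base" "choices ! j = (p, d, ops)"
  shows "p \<in> states M" "length ops = k"
  using nth_mem[OF assms(1)] assms(2) by (auto simp: set_choices)

lemma trans_wellformed:
  assumes "q \<in> states M" "q \<notin> halting_states M" "length ts = k" "(p, d, ops) \<in> trans M q a ts"
  shows "p \<in> states M" "length ops = k" "a = LeftEnd \<Longrightarrow> d \<noteq> MoveLeft"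
    "a = RightEnd \<Longrightarrow> d \<noteq> MoveRight" "\<And>i. i < k \<Longrightarrow> ts ! i = Bottom \<Longrightarrow> ops ! i \<noteq> Pop"
proof -
  have "\<forall>(p, d, ops) \<in> trans M q a ts. p \<in> states M \<and> length ops = k \<and>
           (a = LeftEnd \<longrightarrow> d \<noteq> MoveLeft) \<and> (a = RightEnd \<longrightarrow> d \<noteq> MoveRight) \<and>
           (\<forall>i<k. ts ! i = Bottom \<longrightarrow> ops ! i \<noteq> Pop)"
    using ncta assms(1-3) unfolding is_ncta_def by blast
  with assms(4) show "p \<in> states M" "length ops = k" "a = LeftEnd \<Longrightarrow> d \<noteq> MoveLeft"
    "a = RightEnd \<Longrightarrow> d \<noteq> MoveRight" "\<And>i. i < k \<Longrightarrow> ts ! i = Bottom \<Longrightarrow> ops ! i \<noteq> Pop"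
    by blast+
qed

lemma length_tops [simp]: "length (tops k v) = k"
  by (simp add: tops_def)

lemma map2_stacks_trans:
  assumes "q \<in> states M" "q \<notin> halting_states M" "(p, d, ops) \<in> trans M q a (tops k v)"
  shows "map2 apply_op ops (stacks k v) =
    stacks k (\<lambda>r. if r < k then op_val (ops ! r) (v r) else 0)"
  by (rule map2_stacks) (use trans_wellformed[OF assms(1,2) _ assms(3)] in \<open>auto simp: tops_nth\<close>)

lemma proper_start: "proper start"
  using index[OF init_in_states] by (simp add: proper_def start_def)

lemma proper_choice_step:
  assumes "proper s" "j < base"
  shows "proper (choice_step x j s)"
proof -
  obtain i h v where s: "s = (i, h, v)" by (cases s)
  obtain p d ops where j: "choices ! j = (p, d, ops)" by (cases "choices ! j")
  have "index p \<le> length qs" using choices_nth[OF assms(2) j] index by force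
  with assms(1) j s show ?thesis by (auto simp: proper_def choice_step_def)
qed

lemma run_simps [simp]:
  "run x [] s = s"
  "run x (j # js) s = run x js (choice_step x j s)"
  "run x (js @ js') s = run x js' (run x js s)"
  by (simp_all add: run_def)

lemma proper_run: "proper s \<Longrightarrow> set js \<subseteq> {..<base} \<Longrightarrow> proper (run x js s)"
  by (induction js arbitrary: s) (simp_all add: proper_choice_step)

lemma not_running_run: "\<not> running (fst s) \<Longrightarrow> \<not> running (fst (run x js s))"
proof (induction js arbitrary: s)
  case (Cons j js)
  from Cons.prems have "\<not> running (fst (choice_step x j s))"
    by (cases s) (simp add: choice_step_def running_def)
  with Cons.IH show ?case by simp
qed simp

text \<open>Death is permanent, so every prefix of a surviving sequence survives.\<close>

lemma running_run_take:
  "running (fst (run x js s)) \<Longrightarrow> running (fst (run x (take n js) s))"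
  using not_running_run[of "run x (take n js) s" x "drop n js"]
  by (metis append_take_drop_id run_simps(3))

lemma step_choice_step:
  assumes "\<not> accepting (fst s)" "running (fst (choice_step x j s))"
  shows "step M x (conf_of s) (conf_of (choice_step x j s))"
proof -
  obtain i h v where s: "s = (i, h, v)" by (cases s)
  obtain p d ops where j: "choices ! j = (p, d, ops)" by (cases "choices ! j")
  have i: "running i" "qs ! i \<notin> rej_states M"
    using assms(2) s by (auto simp: choice_step_def running_def split: if_splits)
  then have i': "qs ! i \<notin> halting_states M" "qs ! i \<in> states M"
    using assms(1) s qs_nth by (auto simp: accepting_def running_def halting_states_def)
  have t: "(p, d, ops) \<in> trans M (qs ! i) (tape_at x h) (tops k v)"
    and eq: "choice_step x j s =
      (index p, move_head d h, \<lambda>r. if r < k then op_val (ops ! r) (v r) else 0)"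
    using assms(2) i i' s j
    by (auto simp: choice_step_def running_def halting_states_def split: if_splits)
  have "p \<in> states M" using trans_wellformed(1)[OF i'(2,1) _ t] by simp
  then have "qs ! index p = p" using index by blast
  with eq map2_stacks_trans[OF i'(2,1) t] t i' show ?thesis
    by (auto simp: step_def conf_of_def s map_hd_stacks intro!: bexI[of _ "(p, d, ops)"])
qed

lemma conf_of_start: "conf_of start = init_conf k M"
  using index[OF init_in_states]
  by (simp add: conf_of_def start_def init_conf_def stacks_def stack_def map_replicate_const)

lemma running_start: "running (fst start)"
  using index[OF init_in_states] by (simp add: running_def start_def)

text \<open>The first hypothesis rules out idling, hence every surviving choice step is a step of
  \<open>M\<close>.\<close>

lemma reachable_run:
  assumes "\<And>c. (step M x)\<^sup>*\<^sup>* (init_conf k M) c \<Longrightarrow> fst c \<notin> acc_states M"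
    and "set js \<subseteq> {..<base}" and "running (fst (run x js start))"
  shows "(step M x)\<^sup>*\<^sup>* (init_conf k M) (conf_of (run x js start))"
  using assms(2,3)
proof (induction js rule: rev_induct)
  case Nil
  then show ?case by (simp add: conf_of_start)
next
  case (snoc j js)
  let ?s = "run x js start"
  have "running (fst ?s)" using running_run_take[OF snoc.prems(2), of "length js"] by simp
  then have reach: "(step M x)\<^sup>*\<^sup>* (init_conf k M) (conf_of ?s)" using snoc by simp
  then have "\<not> accepting (fst ?s)" using assms(1) by (force simp: accepting_def conf_of_def)
  then have "step M x (conf_of ?s) (conf_of (choice_step x j ?s))"
    using snoc.prems(2) by (intro step_choice_step) simp_all
  with reach show ?case by simp
qed

text \<open>Every move of \<open>M\<close> is well-formed and therefore listed in
  \<open>choices\<close>; its position is the digit to append.\<close>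

lemma run_reachable:
  assumes "(step M x)\<^sup>*\<^sup>* (init_conf k M) c"
  shows "\<exists>js. set js \<subseteq> {..<base} \<and> running (fst (run x js start)) \<and> conf_of (run x js start) = c"
  using assms
proof induction
  case base
  show ?case by (rule exI[of _ "[]"]) (simp add: running_start conf_of_start)
next
  case (step c c')
  then obtain js where js: "set js \<subseteq> {..<base}" "running (fst (run x js start))"
    "conf_of (run x js start) = c" by blast
  obtain i h v where s: "run x js start = (i, h, v)" by (cases "run x js start")
  with js have c: "c = (qs ! i, h, stacks k v)" and i: "running i" by (auto simp: conf_of_def)
  with step.hyps(2) obtain p d ops where t: "(p, d, ops) \<in> trans M (qs ! i) (tape_at x h) (tops k v)"
    and nh: "qs ! i \<notin> halting_states M"
    and c': "c' = (p, move_head d h, map2 apply_op ops (stacks k v))"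
    by (auto simp: step_def map_hd_stacks)
  have q: "qs ! i \<in> states M" using i qs_nth by (simp add: running_def)
  have p: "p \<in> states M" "length ops = k" using trans_wellformed[OF q nh _ t] by simp_all
  then have "(p, d, ops) \<in> set choices" by (simp add: set_choices)
  then obtain j where j: "j < base" "choices ! j = (p, d, ops)" by (auto simp: in_set_conv_nth)
  have eq: "run x (js @ [j]) start =
      (index p, move_head d h, \<lambda>r. if r < k then op_val (ops ! r) (v r) else 0)"
    using s i nh t j by (simp add: choice_step_def halting_states_def)
  show ?case
  proof (intro exI[of _ "js @ [j]"] conjI)
    show "set (js @ [j]) \<subseteq> {..<base}" using js j by simp
    show "running (fst (run x (js @ [j]) start))"
      using index[OF p(1)] by (simp only: eq) (simp add: running_def)
    show "conf_of (run x (js @ [j]) start) = c'"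
      using index[OF p(1)] map2_stacks_trans[OF q nh t] by (simp only: eq) (simp add: conf_of_def c')
  qed
qed

lemma accepting_run_if_accepting_path:
  assumes "accepting_path k M x cs"
  shows "\<exists>js. set js \<subseteq> {..<base} \<and> accepting (fst (run x js start))"
proof -
  have "(step M x)\<^sup>*\<^sup>* (init_conf k M) (last cs)"
    using assms finite_path_iff_reachable unfolding accepting_path_def by blast
  then obtain js where js: "set js \<subseteq> {..<base}" "running (fst (run x js start))"
    "conf_of (run x js start) = last cs" using run_reachable by blast
  then have "accepting (fst (run x js start))"
    using assms unfolding accepting_path_def
    by (metis accepting_def conf_of_def fst_conv running_def)
  with js(1) show ?thesis by blast
qed

text \<open>An accepting state halts, so a path ending there is maximal and would have to be
  rejecting as well.\<close>

lemma not_accepting_if_all_paths_rejecting: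
  assumes "all_paths_rejecting k M x" "(step M x)\<^sup>*\<^sup>* (init_conf k M) c"
  shows "fst c \<notin> acc_states M"
proof
  assume acc: "fst c \<in> acc_states M"
  obtain cs where cs: "finite_path k M x cs" "last cs = c"
    using assms(2) finite_path_iff_reachable by blast
  have "\<not> step M x c d" for d using acc by (auto simp: step_def halting_states_def)
  with cs have "maximal_path k M x cs" by (simp add: maximal_path_def)
  then have "fst c \<in> rej_states M"
    using assms(1) cs by (auto simp: all_paths_rejecting_def rejecting_path_def)
  with acc ncta show False by (auto simp: is_ncta_def)
qed

text \<open>Koenig's lemma for the finitely branching tree of computations.\<close>

lemma runs_die_if_all_paths_rejecting:
  assumes rej: "all_paths_rejecting k M x"
  shows "\<exists>t. \<forall>js. length js = t \<longrightarrow> set js \<subseteq> {..<base} \<longrightarrow> \<not> running (fst (run x js start))"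
proof (rule ccontr)
  assume contra: "\<not> ?thesis"
  \<comment> \<open>The infinite subtrees of Koenig's argument: some sequence of each length
    survives from \<open>s\<close>.\<close>
  define long where "long s \<longleftrightarrow>
    (\<forall>t. \<exists>js. length js = t \<and> set js \<subseteq> {..<base} \<and> running (fst (run x js s)))" for s
  have long_start: "long start" using contra by (auto simp: long_def)
  have long_succ: "\<exists>j<base. long (choice_step x j s)" if "long s" for s
  proof (rule ccontr)
    assume "\<not> ?thesis"
    then have "\<forall>j. \<exists>t. j < base \<longrightarrow> (\<forall>js. length js = t \<longrightarrow> set js \<subseteq> {..<base} \<longrightarrow>
        \<not> running (fst (run x js (choice_step x j s))))"
      unfolding long_def by blast
    then obtain T where T: "\<And>j js. j < base \<Longrightarrow> length js = T j \<Longrightarrow> set js \<subseteq> {..<base} \<Longrightarrow>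
        \<not> running (fst (run x js (choice_step x j s)))"
      by metis
    from \<open>long s\<close> obtain js where js: "length js = Suc (\<Sum>j<base. T j)" "set js \<subseteq> {..<base}"
      "running (fst (run x js s))" unfolding long_def by blast
    then obtain j js' where jjs: "js = j # js'" by (cases js) auto
    then have j: "j < base" and js': "set js' \<subseteq> {..<base}" using js by auto
    \<comment> \<open>\<open>js\<close> was taken one longer than the sum of all \<open>T j\<close>,
      so after its first choice enough choices remain, whichever child was entered.\<close>
    have "T j \<le> length js'" using member_le_sum[of j "{..<base}" T] j js(1) jjs by simp
    moreover have "running (fst (run x (take (T j) js') (choice_step x j s)))"
      using js(3) jjs by (intro running_run_take) simp
    moreover have "set (take (T j) js') \<subseteq> {..<base}"
      using js' set_take_subset by fast
    ultimately show False using T[OF j, of "take (T j) js'"] by simp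
  qed
  \<comment> \<open>Reachability is carried along since it excludes accepting states, and only then
    is a surviving choice step a step of \<open>M\<close> rather than idling.\<close>
  let ?P = "\<lambda>s. long s \<and> (step M x)\<^sup>*\<^sup>* (init_conf k M) (conf_of s)"
  have "\<exists>f. \<forall>n. ?P (f n) \<and> (n = 0 \<longrightarrow> f n = start) \<and> step M x (conf_of (f n)) (conf_of (f (Suc n)))"
  proof -
    have "\<exists>f. \<forall>n. (?P (f n) \<and> (n = 0 \<longrightarrow> f n = start)) \<and>
        step M x (conf_of (f n)) (conf_of (f (Suc n)))"
    proof (rule dependent_nat_choice)
      show "\<exists>s. ?P s \<and> (0 = 0 \<longrightarrow> s = start)" 
        using long_start conf_of_start by (intro exI[of _ start]) simp
    next
      fix s and n :: nat
      assume s: "?P s \<and> (n = 0 \<longrightarrow> s = start)"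
      then obtain j where j: "long (choice_step x j s)" using long_succ by blast
      then have "running (fst (choice_step x j s))"
        unfolding long_def by (metis length_0_conv run_simps(1))
      moreover have "\<exists>js. length js = 0 \<and> set js \<subseteq> {..<base} \<and> running (fst (run x js s))"
        using s unfolding long_def by blast
      then have "running (fst s)" by simp
      then have "\<not> accepting (fst s)"
        using not_accepting_if_all_paths_rejecting[OF rej, of "conf_of s"] s
        by (simp add: accepting_def conf_of_def)
      ultimately have "step M x (conf_of s) (conf_of (choice_step x j s))"
        by (intro step_choice_step)
      with s j show "\<exists>s'. (?P s' \<and> (Suc n = 0 \<longrightarrow> s' = start)) \<and> step M x (conf_of s) (conf_of s')"
        by (intro exI[of _ "choice_step x j s"]) auto
    qed
    then show ?thesis by blast
  qed
  then obtain f where f: "f 0 = start" "\<And>n. step M x (conf_of (f n)) (conf_of (f (Suc n)))"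
    by blast
  then have "infinite_path k M x (\<lambda>n. conf_of (f n))"
    by (simp add: infinite_path_def conf_of_start)
  with rej show False by (auto simp: all_paths_rejecting_def)
qed

definition result :: "'a list \<Rightarrow> nat \<Rightarrow> nat" where
  "result x m = fst (run x (digits base m) start)"

lemma result_if_all_paths_rejecting:
  assumes "all_paths_rejecting k M x"
  shows "\<not> accepting (result x m)" and "\<exists>m0. \<forall>m\<ge>m0. \<not> running (result x m)"
proof -
  show "\<not> accepting (result x m)"
  proof
    assume acc: "accepting (result x m)"
    then have "running (fst (run x (digits base m) start))"
      by (simp add: accepting_def running_def result_def)
    then have "(step M x)\<^sup>*\<^sup>* (init_conf k M) (conf_of (run x (digits base m) start))"
      using not_accepting_if_all_paths_rejecting[OF assms] set_digits[OF base_pos]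
      by (intro reachable_run)
    then show False
      using not_accepting_if_all_paths_rejecting[OF assms] acc
      by (force simp: accepting_def result_def conf_of_def)
  qed
  obtain t where t: "\<And>js. length js = t \<Longrightarrow> set js \<subseteq> {..<base} \<Longrightarrow>
      \<not> running (fst (run x js start))"
    using runs_die_if_all_paths_rejecting[OF assms] by blast
  let ?short = "{js. set js \<subseteq> {..<base} \<and> length js \<le> t}"
  \<comment> \<open>A run surviving more than \<open>t\<close> choices would have a surviving prefix
    of length \<open>t\<close>; there are finitely many shorter sequences over finitely many
    choices.\<close>
  have "{m. running (result x m)} \<subseteq> undigits base ` ?short"
  proof
    fix m assume m: "m \<in> {m. running (result x m)}"
    have "length (digits base m) \<le> t"
    proof (rule ccontr)
      assume "\<not> ?thesis"
      moreover have "running (fst (run x (take t (digits base m)) start))"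
        using m by (intro running_run_take) (simp add: result_def)
      moreover have "set (take t (digits base m)) \<subseteq> {..<base}"
        using set_digits[OF base_pos] set_take_subset by fast
      ultimately show False using t[of "take t (digits base m)"] by simp
    qed
    with set_digits[OF base_pos] undigits_digits[of base m]
    show "m \<in> undigits base ` ?short" by (metis (mono_tags, lifting) image_eqI mem_Collect_eq)
  qed
  then have "finite {m. running (result x m)}"
    by (rule finite_subset) (simp add: finite_lists_length_le)
  then obtain m0 where "\<forall>m\<in>{m. running (result x m)}. m < m0"
    using finite_nat_set_iff_bounded by blast
  then have "\<forall>m\<ge>m0. \<not> running (result x m)" by fastforce
  then show "\<exists>m0. \<forall>m\<ge>m0. \<not> running (result x m)" ..
qed

lemma result_undigits:
  "set js \<subseteq> {..<base} \<Longrightarrow> result x (undigits base js) = fst (run x js start)"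
  by (simp add: result_def digits_undigits)

end

section \<open>The exhaustive search program\<close>

context source
begin

text \<open>
  Registers: 0 holds the current state, 1 and 2 the current choice and its complement, 3 the
  remaining choices, 4 and 8 are scratch, 5 the number of the current choice sequence, 6 the
  budget of further sequences to be tried, 7 the flag for an accepting computation found.
  From 9 on there are the counters of \<open>M\<close>.
\<close>

definition counters :: "(nat \<Rightarrow> nat) \<Rightarrow> nat \<Rightarrow> nat" where
  "counters v = (\<lambda>r. if r < k then v (9 + r) else 0)"

definition put :: "nat \<Rightarrow> (nat \<Rightarrow> nat) \<Rightarrow> (nat \<Rightarrow> nat) \<Rightarrow> nat \<Rightarrow> nat" where
  "put i w v = (\<lambda>r. if r = 0 then i else if 9 \<le> r \<and> r < 9 + k then w (r - 9) else v r)"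

text \<open>The program text for one known choice \<open>j\<close> and one known state
  \<open>i\<close>; only the tape symbol and the zero pattern are examined at run time. Register 0
  is zero on entry, so the increments set the next state.\<close>

definition leaf :: "nat \<Rightarrow> nat \<Rightarrow> 'a com" where
  "leaf j i =
     (if \<not> running i \<or> qs ! i \<in> rej_states M then incs (length qs) 0
      else if qs ! i \<in> acc_states M then incs i 0
      else (case choices ! j of (p, d, ops) \<Rightarrow>
        with_tops 9 k (\<lambda>ts. IfTape (\<lambda>a. (p, d, ops) \<in> trans M (qs ! i) a ts)
          (ops_prog 9 ops ;; Move d ;; incs (index p) 0)
          (incs (length qs) 0))))"

definition step_prog :: "'a com" where
  "step_prog = select 1 base (\<lambda>j. select 0 (Suc (length qs)) (leaf j))"

text \<open>Registers 1 and 2 always add up to \<open>base - 1\<close>. When register 2 is empty,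
  the remainder wraps around to zero and register 4 counts one more multiple of
  \<open>base\<close>.\<close>

definition divmod_loop :: "'a com" where
  "divmod_loop = While 3 (Dec 3 ;; IfZero 2 (transfer 1 1 2 ;; Inc 4) (Dec 2 ;; Inc 1))"

text \<open>The initial \<open>Dec 3\<close> is the subtraction of 1 in bijective numeration.
  Register 1 ends up with the digit and register 3 with the number of the remaining
  sequence.\<close>

definition read_choice :: "'a com" where
  "read_choice = Dec 3 ;; incs (base - 1) 2 ;; divmod_loop ;; transfer 1 4 3 ;; clear 2"

definition run_loop :: "'a com" where
  "run_loop = While 3 (read_choice ;; step_prog)"

text \<open>Each sequence is replayed from the initial configuration, as only one configuration is
  ever stored. Register 8 carries the sequence number back to register 5.\<close>

definition simulate :: "'a com" where
  "simulate = transfer2 1 5 3 8 ;; transfer 1 8 5 ;; rewind 4 ;; clears 9 k ;; clear 0 ;;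
     incs (index (init_state M)) 0 ;; run_loop"

text \<open>The \<open>transfer2\<close> adds \<open>base * base\<close> times the sequence number
  to the budget and the last \<open>incs\<close> adds \<open>base * base\<close> once more. Clearing
  register 6 ends the search as soon as an accepting run is found.\<close>

definition evaluate :: "'a com" where
  "evaluate = select 0 (Suc (length qs)) (\<lambda>i.
     if \<not> running i then Dec 6
     else if accepting i then Inc 7 ;; clear 6
     else transfer2 (base * base) 5 6 8 ;; transfer 1 8 5 ;; incs (base * base) 6) ;; Inc 5"

text \<open>The initial budget 1 pays for the empty sequence, whose number is 0.\<close>

definition search :: "'a com" where
  "search = Inc 6 ;; While 6 (simulate ;; evaluate)"

section \<open>Correctness of the search program\<close>

lemma put_simps:
  "put i w v 0 = i"
  "0 < r \<Longrightarrow> r < 9 \<Longrightarrow> put i w v r = v r"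
  by (auto simp: put_def)

lemma counters_put: "(\<And>r. k \<le> r \<Longrightarrow> w r = 0) \<Longrightarrow> counters (put i w v) = w"
  by (auto simp: counters_def put_def fun_eq_iff)

lemma put_put: "put i w (put i' w' v) = put i w v"
  by (auto simp: put_def fun_eq_iff)

lemma put_upd_0: "put i w (v(0 := n)) = put i w v"
  by (auto simp: put_def fun_eq_iff)

lemma put_self: "put (v 0) (counters v) v = v"
  by (auto simp: put_def counters_def fun_eq_iff)

lemma put_counters: "put i (counters v) v = v(0 := i)"
  by (auto simp: put_def counters_def fun_eq_iff)

lemma counters_upd: "r < 9 \<Longrightarrow> counters (v(r := n)) = counters v"
  by (auto simp: counters_def fun_eq_iff)

lemma counters_outside: "k \<le> r \<Longrightarrow> counters v r = 0"
  by (simp add: counters_def)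

lemma tops_counters: "map (\<lambda>i. if v i = 0 then Bottom else One) [9..<9 + k] = tops k (counters v)"
  by (rule nth_equalityI) (auto simp: tops_def counters_def)

lemma clamp_id: "(a = LeftEnd \<Longrightarrow> d \<noteq> MoveLeft) \<Longrightarrow> (a = RightEnd \<Longrightarrow> d \<noteq> MoveRight) \<Longrightarrow> clamp d a = d"
  by (cases d; cases a) auto

lemma wp_leaf:
  assumes "v 0 = 0" "j < base"
  shows "wp x (leaf j i) Q (h, v) \<longleftrightarrow>
    (case choice_step x j (i, h, counters v) of (i', h', w) \<Rightarrow> Q (h', put i' w v))"
proof -
  obtain p d ops where j: "choices ! j = (p, d, ops)" by (cases "choices ! j")
  show ?thesis
  proof (cases "running i \<and> qs ! i \<notin> rej_states M \<and> qs ! i \<notin> acc_states M")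
    case False
    with assms show ?thesis by (auto simp: leaf_def choice_step_def put_counters)
  next
    case True
    then have q: "qs ! i \<in> states M" "qs ! i \<notin> halting_states M"
      by (auto simp: running_def halting_states_def qs_nth)
    show ?thesis
    proof (cases "(p, d, ops) \<in> trans M (qs ! i) (tape_at x h) (tops k (counters v))")
      case False
      with True assms j show ?thesis
        by (simp add: leaf_def choice_step_def put_counters wp_with_tops tops_counters)
    next
      case trans: True
      note wf = trans_wellformed[OF q _ trans, simplified]
      let ?u = "\<lambda>s. if 9 \<le> s \<and> s < 9 + length ops then op_val (ops ! (s - 9)) (v s) else v s"
      let ?w = "\<lambda>r. if r < k then op_val (ops ! r) (counters v r) else 0"
      have ops: "wp x (ops_prog 9 ops) Q' (h, v) \<longleftrightarrow> Q' (h, ?u)" for Q'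
        by (rule wp_ops_prog) (use wf(2,5) in \<open>auto simp: tops_nth counters_def\<close>)
      have "clamp d (tape_at x h) = d"
        using wf(3,4) by (rule clamp_id)
      moreover have "?u(0 := ?u 0 + index p) = put (index p) ?w v"
        using assms(1) wf(2) by (auto simp: put_def counters_def fun_eq_iff)
      ultimately have "wp x (ops_prog 9 ops ;; Move d ;; incs (index p) 0) Q (h, v) \<longleftrightarrow>
          Q (move_head d h, put (index p) ?w v)"
        by (simp only: wp_simps ops wp_incs)
      moreover have "wp x (leaf j i) Q (h, v) \<longleftrightarrow>
          wp x (ops_prog 9 ops ;; Move d ;; incs (index p) 0) Q (h, v)"
        using True trans j by (simp add: leaf_def wp_with_tops tops_counters del: wp_simps(5))
      moreover have "choice_step x j (i, h, counters v) = (index p, move_head d h, ?w)"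
        using True trans j by (simp add: choice_step_def)
      ultimately show ?thesis by simp
    qed
  qed
qed

lemma wp_step_prog:
  assumes "v 1 < base" "v 0 \<le> length qs"
  shows "wp x step_prog Q (h, v) \<longleftrightarrow>
    (case choice_step x (v 1) (v 0, h, counters v) of (i, h', w) \<Rightarrow> Q (h', put i w (v(1 := 0))))"
  using assms wp_leaf[of "v(1 := 0, 0 := 0)" "v 1" x "v 0" Q h]
  by (simp add: step_prog_def wp_select put_upd_0 counters_upd del: select.simps)

lemma wp_divmod_loop:
  assumes "v 1 + v 2 = base - 1"
  shows "wp x divmod_loop Q (h, v) \<longleftrightarrow>
    Q (h, v(3 := 0, 1 := (v 1 + v 3) mod base, 2 := base - 1 - (v 1 + v 3) mod base,
      4 := v 4 + (v 1 + v 3) div base))"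
  using assms
proof (induction "v 3" arbitrary: v)
  case 0
  have "v 1 < base" using 0 base_pos by linarith
  then have "v(3 := 0, 1 := (v 1 + v 3) mod base, 2 := base - 1 - (v 1 + v 3) mod base,
      4 := v 4 + (v 1 + v 3) div base) = v"
    using 0 by (auto simp: fun_eq_iff)
  moreover have "wp x divmod_loop Q (h, v) \<longleftrightarrow> Q (h, v)"
    using 0 by (simp add: divmod_loop_def wp_While_unfold)
  ultimately show ?case by metis
next
  case (Suc n)
  have v3: "v 3 = Suc n" using Suc by simp
  show ?case
  proof (cases "v 2 = 0")
    case True
    let ?w = "v(3 := n, 2 := v 1, 1 := 0, 4 := Suc (v 4))"
    have v1: "v 1 + 1 = base" using True Suc.prems base_pos by linarith
    have w: "v(3 := n, 1 := 0, 2 := v 1, 4 := Suc (v 4)) = ?w" by (auto simp: fun_eq_iff)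
    have "wp x divmod_loop Q (h, v) \<longleftrightarrow> wp x divmod_loop Q (h, ?w)"
      using True v3 w by (simp add: divmod_loop_def wp_While_unfold[where v = v])
    also have "\<dots> \<longleftrightarrow> Q (h, ?w(3 := 0, 1 := (?w 1 + ?w 3) mod base,
        2 := base - 1 - (?w 1 + ?w 3) mod base, 4 := ?w 4 + (?w 1 + ?w 3) div base))"
      by (rule Suc.hyps) (use Suc.prems True in auto)
    also have "?w(3 := 0, 1 := (?w 1 + ?w 3) mod base,
        2 := base - 1 - (?w 1 + ?w 3) mod base, 4 := ?w 4 + (?w 1 + ?w 3) div base)
      = v(3 := 0, 1 := n mod base, 2 := base - 1 - n mod base, 4 := v 4 + (n div base + 1))"
      by (auto simp: fun_eq_iff)
    also have "n mod base = (v 1 + v 3) mod base"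
    proof -
      have "v 1 + v 3 = n + base" using v1 v3 by simp
      then show ?thesis by simp
    qed
    also have "n div base + 1 = (v 1 + v 3) div base"
    proof -
      have "v 1 + v 3 = n + base" using v1 v3 by simp
      then show ?thesis using base_pos by simp
    qed
    finally show ?thesis .
  next
    case False
    let ?w = "v(3 := n, 2 := v 2 - 1, 1 := Suc (v 1))"
    have "wp x divmod_loop Q (h, v) \<longleftrightarrow> wp x divmod_loop Q (h, ?w)"
      using False v3 by (simp add: divmod_loop_def wp_While_unfold[where v = v])
    also have "\<dots> \<longleftrightarrow> Q (h, ?w(3 := 0, 1 := (?w 1 + ?w 3) mod base,
        2 := base - 1 - (?w 1 + ?w 3) mod base, 4 := ?w 4 + (?w 1 + ?w 3) div base))"
      by (rule Suc.hyps) (use Suc.prems False in auto)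
    also have "?w(3 := 0, 1 := (?w 1 + ?w 3) mod base,
        2 := base - 1 - (?w 1 + ?w 3) mod base, 4 := ?w 4 + (?w 1 + ?w 3) div base)
      = v(3 := 0, 1 := (v 1 + v 3) mod base, 2 := base - 1 - (v 1 + v 3) mod base,
          4 := v 4 + (v 1 + v 3) div base)"
      using v3 by (auto simp: fun_eq_iff)
    finally show ?thesis .
  qed
qed

lemma wp_read_choice:
  assumes "v 1 = 0" "v 2 = 0" "v 3 \<noteq> 0" "v 4 = 0"
  shows "wp x read_choice Q (h, v) \<longleftrightarrow>
    Q (h, v(1 := (v 3 - 1) mod base, 3 := (v 3 - 1) div base))"
proof -
  let ?w = "v(3 := v 3 - 1, 2 := base - 1)"
  let ?m = "(v 3 - 1) mod base" and ?d = "(v 3 - 1) div base"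
  define u where "u = ?w(3 := 0, 1 := (?w 1 + ?w 3) mod base,
      2 := base - 1 - (?w 1 + ?w 3) mod base, 4 := ?w 4 + (?w 1 + ?w 3) div base)"
  have "wp x read_choice Q (h, v) \<longleftrightarrow>
      wp x (divmod_loop ;; transfer 1 4 3 ;; clear 2) Q (h, ?w)"
    using assms by (simp add: read_choice_def)
  also have "\<dots> \<longleftrightarrow> wp x (transfer 1 4 3 ;; clear 2) Q (h, u)"
    unfolding wp_simps(5)[of x divmod_loop] u_def by (rule wp_divmod_loop) (use assms in auto)
  also have "\<dots> \<longleftrightarrow> Q (h, u(4 := 0, 3 := u 3 + u 4, 2 := 0))"
    by simp
  also have "u(4 := 0, 3 := u 3 + u 4, 2 := 0) = v(1 := ?m, 3 := ?d)"
    using assms by (auto simp: fun_eq_iff u_def)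
  finally show ?thesis .
qed

lemma wp_run_loop:
  assumes "v 1 = 0" "v 2 = 0" "v 4 = 0" "v 0 \<le> length qs"
  shows "wp x run_loop Q (h, v) \<longleftrightarrow>
    (case run x (digits base (v 3)) (v 0, h, counters v) of (i, h', w) \<Rightarrow> Q (h', put i w (v(3 := 0))))"
  using assms
proof (induction "v 3" arbitrary: v h rule: less_induct)
  case less
  show ?case
  proof (cases "v 3 = 0")
    case True
    then have "v(3 := 0) = v" by (auto simp: fun_eq_iff)
    with True show ?thesis
      by (simp add: run_loop_def wp_While_unfold digits.simps put_self)
  next
    case False
    let ?j = "(v 3 - 1) mod base" and ?n = "(v 3 - 1) div base"
    let ?s = "choice_step x ?j (v 0, h, counters v)"
    obtain i h' w where s: "?s = (i, h', w)" by (cases ?s)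
    let ?u = "put i w (v(1 := 0, 3 := ?n))"
    have j: "?j < base" using base_pos by simp
    have "proper (v 0, h, counters v)"
      using less.prems by (simp add: proper_def counters_outside)
    from proper_choice_step[OF this j, of x] have wf: "i \<le> length qs" "\<And>r. k \<le> r \<Longrightarrow> w r = 0"
      unfolding s by (auto simp: proper_def)
    let ?t = "v(1 := ?j, 3 := ?n)"
    have t: "?t(1 := 0) = v(1 := 0, 3 := ?n)" "?t 1 = ?j" "?t 0 = v 0" "counters ?t = counters v"
      by (auto simp: fun_eq_iff counters_def)
    have "wp x run_loop Q (h, v) \<longleftrightarrow> wp x read_choice (wp x step_prog (wp x run_loop Q)) (h, v)"
      unfolding run_loop_def by (subst wp_While_unfold) (use False in simp)
    also have "\<dots> \<longleftrightarrow> wp x step_prog (wp x run_loop Q) (h, ?t)"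
      by (rule wp_read_choice) (use less.prems False in auto)
    also have "\<dots> \<longleftrightarrow> (case choice_step x (?t 1) (?t 0, h, counters ?t) of (i, h', w) \<Rightarrow>
        wp x run_loop Q (h', put i w (?t(1 := 0))))"
      by (rule wp_step_prog) (use j less.prems in auto)
    also have "\<dots> \<longleftrightarrow> wp x run_loop Q (h', ?u)"
      unfolding t s by simp
    also have "\<dots> \<longleftrightarrow> (case run x (digits base (?u 3)) (?u 0, h', counters ?u) of
        (i, h', w) \<Rightarrow> Q (h', put i w (?u(3 := 0))))"
    proof (rule less.hyps)
      have "?n < v 3" using False by (rule pred_div_less)
      then show "?u 3 < v 3" by (simp add: put_simps)
    qed (use less.prems wf in \<open>auto simp: put_simps\<close>)
    also have "?u 3 = ?n" by (simp add: put_simps)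
    also have "(?u 0, h', counters ?u) = (i, h', w)"
      using wf(2) by (simp add: put_simps counters_put)
    also have "run x (digits base ?n) (i, h', w) = run x (digits base (v 3)) (v 0, h, counters v)"
      using False s by (simp add: digits.simps[of base "v 3"])
    also have "?u(3 := 0) = put i w (v(1 := 0, 3 := 0))"
      by (auto simp: put_def fun_eq_iff)
    also have "v(1 := 0, 3 := 0) = v(3 := 0)" using less.prems by (auto simp: fun_eq_iff)
    finally show ?thesis unfolding put_put .
  qed
qed

lemma wp_simulate:
  assumes "v 1 = 0" "v 2 = 0" "v 3 = 0" "v 4 = 0" "v 8 = 0"
  shows "wp x simulate Q (h, v) \<longleftrightarrow>
    (case run x (digits base (v 5)) start of (i, h', w) \<Rightarrow> Q (h', put i w v))"
proof -
  let ?i = "index (init_state M)"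
  let ?t = "v(5 := 0, 3 := v 5, 8 := 0, 5 := v 5)"
  let ?u = "put ?i (\<lambda>_. 0) (v(3 := v 5))"
  have "?t = v(3 := v 5)" using assms by (auto simp: fun_eq_iff)
  then have "wp x simulate Q (h, v) \<longleftrightarrow> wp x (rewind 4 ;; clears 9 k ;; clear 0 ;; incs ?i 0 ;; run_loop) Q (h, v(3 := v 5))"
    using assms by (simp add: simulate_def fun_upd_twist)
  also have "\<dots> \<longleftrightarrow> wp x (clears 9 k ;; clear 0 ;; incs ?i 0 ;; run_loop) Q (0, v(3 := v 5))"
    by (subst wp_simps(5), subst wp_rewind) (use assms in auto)
  also have "\<dots> \<longleftrightarrow> wp x run_loop Q (0, ?u)"
    by (simp add: wp_clears) (auto intro!: arg_cong[where f = "\<lambda>u. wp x run_loop Q (0, u)"] simp: put_def fun_eq_iff)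
  also have "\<dots> \<longleftrightarrow> (case run x (digits base (?u 3)) (?u 0, 0, counters ?u) of
      (i, h', w) \<Rightarrow> Q (h', put i w (?u(3 := 0))))"
    by (rule wp_run_loop) (use assms index[OF init_in_states] in \<open>auto simp: put_simps\<close>)
  also have "(?u 0, 0, counters ?u) = start"
    by (simp add: start_def put_simps counters_put)
  also have "?u 3 = v 5" by (simp add: put_simps)
  also have "?u(3 := 0) = put ?i (\<lambda>_. 0) v"
    using assms by (auto simp: put_def fun_eq_iff)
  finally show ?thesis unfolding put_put .
qed

lemma wp_evaluate:
  assumes "v 0 \<le> length qs" "v 6 \<noteq> 0" "v 8 = 0"
  shows "wp x evaluate Q (h, v) \<longleftrightarrow>
    Q (h, if \<not> running (v 0) then v(0 := 0, 5 := Suc (v 5), 6 := v 6 - 1)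
      else if accepting (v 0) then v(0 := 0, 5 := Suc (v 5), 6 := 0, 7 := Suc (v 7))
      else v(0 := 0, 5 := Suc (v 5), 6 := v 6 + base * base * (v 5 + 1)))"
proof -
  have "v(0 := 0, 5 := v 5, 6 := v 6 + base * base * v 5 + base * base, 8 := 0, 5 := Suc (v 5))
      = v(0 := 0, 5 := Suc (v 5), 6 := v 6 + base * base * (v 5 + 1))"
    using assms by (auto simp: fun_eq_iff)
  then show ?thesis
    using assms by (auto simp: evaluate_def wp_select fun_upd_twist simp del: select.simps)
qed

end

text \<open>Here \<open>n\<close> is the number of states and \<open>n * (3 * 3 ^ k)\<close> the
  number of choices. The first summand accounts for \<open>evaluate\<close> and the second for
  \<open>step_prog\<close>; the others cover reading choices, loading the initial state, clearing
  the counters and fixed overhead. For fixed \<open>k\<close> it is a polynomial in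
  \<open>n\<close>.\<close>

definition size_bound :: "nat \<Rightarrow> nat \<Rightarrow> nat" where
  "size_bound k n =
     (n + 1) * (4 * (n * (3 * 3 ^ k)) * (n * (3 * 3 ^ k)) + 18)
     + (n * (3 * 3 ^ k)) * ((n + 1) * (2 ^ k * (2 * k + 4 * n + 7) + 3) + 4)
     + 2 * (n * (3 * 3 ^ k)) + 2 * n + 4 * k + 100"

lemma size_bound_mono: "m \<le> n \<Longrightarrow> size_bound k m \<le> size_bound k n"
  unfolding size_bound_def by (intro add_mono mult_le_mono order_refl)

lemma size_bound_poly: "\<exists>q :: nat poly. \<forall>n. K * size_bound k (poly p n) = poly q n"
proof -
  let ?b = "p * [:3 * 3 ^ k:]"
  let ?q = "[:K:] * ((p + 1) * ([:4:] * ?b * ?b + [:18:])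
     + ?b * ((p + 1) * ([:2 ^ k:] * ([:2 * k + 7:] + [:4:] * p) + [:3:]) + [:4:])
     + [:2:] * ?b + [:2:] * p + [:4 * k + 100:])"
  have "K * size_bound k (poly p n) = poly ?q n" for n
    by (simp add: size_bound_def algebra_simps)
  then show ?thesis by blast
qed

section \<open>Termination and verdict of the search\<close>

context source
begin

lemma result_le: "result x m \<le> length qs"
  using proper_run[OF proper_start set_digits[OF base_pos]] by (simp add: result_def proper_def)

definition next_budget :: "'a list \<Rightarrow> nat \<Rightarrow> nat \<Rightarrow> nat" where
  "next_budget x m s =
     (if \<not> running (result x m) then s - 1
      else if accepting (result x m) then 0
      else s + base * base * (m + 1))"

definition next_flag :: "'a list \<Rightarrow> nat \<Rightarrow> nat \<Rightarrow> nat" where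
  "next_flag x m f = (if accepting (result x m) then Suc f else f)"

text \<open>Both verdicts share this reduction of the store to three numbers: the next sequence
  \<open>m\<close>, the budget \<open>s\<close> and the flag \<open>f\<close>. What remains in each
  case is an invariant and a well-founded relation.\<close>

lemma search_terminates:
  fixes R :: "((nat \<times> nat) \<times> (nat \<times> nat)) set"
  assumes "wf R" and init: "I 0 1 0"
    and inv: "\<And>m s f. I m s f \<Longrightarrow> s \<noteq> 0 \<Longrightarrow>
      I (Suc m) (next_budget x m s) (next_flag x m f) \<and> ((Suc m, next_budget x m s), (m, s)) \<in> R"
  shows "\<exists>h v m. exec x search (0, \<lambda>_. 0) (h, v) \<and> I m 0 (v 7)"
proof -
  \<comment> \<open>The scratch registers are zero between rounds; head, state register and
    simulated counters may hold leftovers, which \<open>simulate\<close> resets.\<close>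
  define J where "J t \<longleftrightarrow> (let v = snd t in
    v 1 = 0 \<and> v 2 = 0 \<and> v 3 = 0 \<and> v 4 = 0 \<and> v 8 = 0 \<and> I (v 5) (v 6) (v 7))" for t :: store
  let ?f = "\<lambda>t :: store. (snd t 5, snd t 6)"
  have "wp x (While 6 (simulate ;; evaluate)) (\<lambda>t. \<exists>m. I m 0 (snd t 7)) (0, (\<lambda>_. 0)(6 := 1))"
  proof (rule wp_While[where R = "inv_image R ?f" and I = J])
    show "wf (inv_image R ?f)" using \<open>wf R\<close> by (rule wf_inv_image)
    show "J (0, (\<lambda>_. 0)(6 := 1))" using init by (simp add: J_def)
  next
    fix h :: nat and v :: "nat \<Rightarrow> nat"
    assume J: "J (h, v)" and S: "v 6 \<noteq> 0"
    obtain i h' w where run: "run x (digits base (v 5)) start = (i, h', w)"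
      by (cases "run x (digits base (v 5)) start")
    then have i: "i = result x (v 5)" by (simp add: result_def)
    let ?u = "put i w v"
    let ?t = "?u(0 := 0, 5 := Suc (v 5), 6 := next_budget x (v 5) (v 6), 7 := next_flag x (v 5) (v 7))"
    have acc: "running j" if "accepting j" for j
      using that by (simp add: accepting_def running_def)
    have "wp x (simulate ;; evaluate) Q (h, v) \<longleftrightarrow> wp x evaluate Q (h', ?u)" for Q
      using J run by (simp add: J_def wp_simulate)
    moreover have "wp x evaluate Q (h', ?u) \<longleftrightarrow> Q (h', ?t)" for Q
    proof -
      have "wp x evaluate Q (h', ?u) \<longleftrightarrow> Q (h', if \<not> running (?u 0)
          then ?u(0 := 0, 5 := Suc (?u 5), 6 := ?u 6 - 1)
        else if accepting (?u 0) then ?u(0 := 0, 5 := Suc (?u 5), 6 := 0, 7 := Suc (?u 7))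
        else ?u(0 := 0, 5 := Suc (?u 5), 6 := ?u 6 + base * base * (?u 5 + 1)))"
        by (rule wp_evaluate) (use J S i result_le in \<open>auto simp: J_def put_simps\<close>)
      also have "(if \<not> running (?u 0)
          then ?u(0 := 0, 5 := Suc (?u 5), 6 := ?u 6 - 1)
        else if accepting (?u 0) then ?u(0 := 0, 5 := Suc (?u 5), 6 := 0, 7 := Suc (?u 7))
        else ?u(0 := 0, 5 := Suc (?u 5), 6 := ?u 6 + base * base * (?u 5 + 1))) = ?t"
        using acc by (auto simp: next_budget_def next_flag_def put_simps i fun_eq_iff)
      finally show ?thesis .
    qed
    moreover have "J (h', ?t) \<and> ((h', ?t), (h, v)) \<in> inv_image R ?f"
      using inv[of "v 5" "v 6" "v 7"] J S by (simp add: J_def put_simps)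
    ultimately show "wp x (simulate ;; evaluate) (\<lambda>t. J t \<and> (t, (h, v)) \<in> inv_image R ?f) (h, v)"
      by blast
  next
    fix h :: nat and v :: "nat \<Rightarrow> nat"
    assume "J (h, v)" "v 6 = 0"
    then show "\<exists>m. I m 0 (snd (h, v) 7)" by (auto simp: J_def)
  qed
  then have "wp x search (\<lambda>t. \<exists>m. I m 0 (snd t 7)) (0, \<lambda>_. 0)"
    by (simp add: search_def)
  then show ?thesis by (auto simp: wp_def)
qed

text \<open>Only finitely many sequences survive, so eventually the budget is used up.\<close>

lemma search_accepts:
  assumes "all_paths_rejecting k M x"
  shows "\<exists>h v. exec x search (0, \<lambda>_. 0) (h, v) \<and> v 7 = 0"
proof -
  obtain m0 where m0: "\<And>m. m0 \<le> m \<Longrightarrow> \<not> running (result x m)"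
    using result_if_all_paths_rejecting(2)[OF assms] by blast
  \<comment> \<open>Before \<open>m0\<close> the distance to \<open>m0\<close> shrinks, whatever the
    budget does; from \<open>m0\<close> on every sequence is dead and the budget shrinks.\<close>
  let ?R = "inv_image (less_than <*lex*> less_than) (\<lambda>(m, s). (m0 - m, s))"
  have "\<exists>h v (m :: nat). exec x search (0, \<lambda>_. 0) (h, v) \<and> v 7 = 0"
  proof (rule search_terminates[where R = ?R and I = "\<lambda>m s f. f = 0"])
    show "wf ?R" by (intro wf_inv_image wf_lex_prod wf_less_than)
  next
    fix m s f :: nat
    assume "f = 0" "s \<noteq> 0"
    then show "next_flag x m f = 0 \<and> ((Suc m, next_budget x m s), (m, s)) \<in> ?R"
      using result_if_all_paths_rejecting(1)[OF assms, of m] m0[of m]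
      by (cases "m0 \<le> m") (auto simp: next_flag_def next_budget_def)
  qed simp
  then show ?thesis by blast
qed

text \<open>
  The budget always suffices to reach the next longer prefix of an accepting choice sequence.
\<close>

lemma search_rejects:
  assumes "accepting_path k M x cs"
  shows "\<exists>h v. exec x search (0, \<lambda>_. 0) (h, v) \<and> v 7 \<noteq> 0"
proof -
  obtain js where js: "set js \<subseteq> {..<base}" "accepting (fst (run x js start))"
    using accepting_run_if_accepting_path[OF assms] by blast
  let ?c = "\<lambda>n. undigits base (take n js)"
  have res: "result x (?c n) = fst (run x (take n js) start)" for n
    using js(1) set_take_subset[of n js] by (intro result_undigits) blast
  have run: "running (result x (?c n))" for n
    unfolding res by (rule running_run_take) (use js(2) in \<open>simp add: accepting_def running_def\<close>)
  have last: "accepting (result x (?c n))" if "length js \<le> n" for n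
    using that js(2) res[of n] by simp
  have step: "?c n < ?c (Suc n)" "?c (Suc n) \<le> ?c n + base * base * (?c n + 1)" if "n < length js" for n
  proof -
    have take: "take (Suc n) js = take n js @ [js ! n]" using that by (rule take_Suc_conv_app_nth)
    have "js ! n < base" using js(1) that nth_mem by blast
    then have "?c (Suc n) \<le> ?c n + base * (base * ?c n + 1)"
      unfolding take by (rule undigits_snoc_le)
    \<comment> \<open>Rounding up to the increment that \<open>evaluate\<close> adds; it uses that
      \<open>base\<close> is at least 1.\<close>
    also have "\<dots> \<le> ?c n + base * base * (?c n + 1)"
    proof -
      have "base * 1 \<le> base * base" using base_pos by (intro mult_le_mono2) linarith
      then show ?thesis by (simp only: add_mult_distrib2 mult.assoc nat_add_left_cancel_le)
    qed
    finally show "?c (Suc n) \<le> ?c n + base * base * (?c n + 1)" .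
    show "?c n < ?c (Suc n)" unfolding take by (rule undigits_snoc_gt[OF base_pos])
  qed
  have bound: "?c n \<le> undigits base js" for n by (rule undigits_take_le[OF base_pos])
  \<comment> \<open>The search cannot get past the number of \<open>js\<close> itself.\<close>
  let ?R = "measure (\<lambda>(m, s). Suc (undigits base js) - m)"
  \<comment> \<open>The numbers from \<open>m\<close> up to, but excluding, \<open>m + s\<close> are
    certain to be tried unless acceptance is found earlier, and one of them belongs to a prefix of
    \<open>js\<close>. A dead sequence raises \<open>m\<close> and lowers \<open>s\<close>, leaving
    the end of this window in place.\<close>
  let ?I = "\<lambda>m s f. if f \<noteq> 0 then s = 0 else \<exists>n. m \<le> ?c n \<and> ?c n < m + s"
  have "\<exists>h v m. exec x search (0, \<lambda>_. 0) (h, v) \<and> ?I m 0 (v 7)"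
  proof (rule search_terminates[where R = ?R and I = ?I])
    show "?I 0 1 0" by (auto intro: exI[of _ 0])
  next
    fix m s f :: nat
    assume I: "?I m s f" and s: "s \<noteq> 0"
    then have f: "f = 0" by (auto split: if_splits)
    with I obtain n where n: "m \<le> ?c n" "?c n < m + s" by auto
    have "m \<le> undigits base js" using n(1) bound[of n] by linarith
    then have "((Suc m, next_budget x m s), (m, s)) \<in> ?R" by auto
    moreover have "?I (Suc m) (next_budget x m s) (next_flag x m f)"
    proof (cases "accepting (result x m)")
      case True
      then have "running (result x m)" by (simp add: accepting_def running_def)
      with True show ?thesis by (simp add: next_flag_def next_budget_def)
    next
      case nacc: False
      have "\<exists>n. Suc m \<le> ?c n \<and> ?c n < Suc m + next_budget x m s"
      \<comment> \<open>If the prefix itself was just tried, it survived without accepting, so it is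
        proper and the enlarged window contains the next prefix. Otherwise the same prefix still
        lies ahead.\<close>
      proof (cases "m = ?c n")
        case True
        then have "n < length js" using nacc last[of n] by (meson not_le)
        moreover have "next_budget x m s = s + base * base * (m + 1)"
          using nacc run[of n] True by (simp add: next_budget_def)
        ultimately show ?thesis
          using step[of n, folded True] s by (intro exI[of _ "Suc n"] conjI) linarith+
      next
        case False
        then have "Suc m \<le> ?c n \<and> ?c n < Suc m + next_budget x m s"
          using n nacc s by (auto simp: next_budget_def)
        then show ?thesis ..
      qed
      with nacc f show ?thesis by (simp add: next_flag_def)
    qed
    ultimately show "?I (Suc m) (next_budget x m s) (next_flag x m f) \<and>
        ((Suc m, next_budget x m s), (m, s)) \<in> ?R" by (rule conjI[rotated])
  qed simp
  then show ?thesis by (auto split: if_splits)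
qed

text \<open>The bound involves \<open>k\<close> alone, not the number of states; this keeps the
  primes of the Goedel numbering constant.\<close>

lemma regs_search: "regs search \<subseteq> {..<9 + k}"
proof -
  have incs: "regs (incs n r) \<subseteq> {..<9 + k}" if "r < 9" for n r
    using regs_incs[of n r] that by (auto dest!: subsetD)
  have transfer: "regs (transfer K a b) \<subseteq> {..<9 + k}" if "a < 9" "b < 9" for K a b
    using regs_transfer[of K a b] that by (auto dest!: subsetD)
  have transfer2: "regs (transfer2 K a b c) \<subseteq> {..<9 + k}" if "a < 9" "b < 9" "c < 9" for K a b c
    using regs_transfer2[of K a b c] that by (auto dest!: subsetD)
  have leaf: "regs (leaf j i) \<subseteq> {..<9 + k}" if "j < base" for i j
  proof -
    obtain p d ops where j: "choices ! j = (p, d, ops)" by (cases "choices ! j")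
    have "regs (ops_prog 9 ops) \<subseteq> {..<9 + k}"
      using regs_ops_prog[of 9 ops] choices_nth(2)[OF that j] by (auto dest!: subsetD)
    moreover have "{9..<9 + k} \<subseteq> {..<9 + k}" by auto
    ultimately have "regs (with_tops 9 k (\<lambda>ts. IfTape (\<lambda>a. (p, d, ops) \<in> trans M (qs ! i) a ts)
        (ops_prog 9 ops ;; Move d ;; incs (index p) 0) (incs (length qs) 0))) \<subseteq> {..<9 + k}"
      by (intro regs_with_tops) (simp_all add: incs)
    then show ?thesis by (simp add: leaf_def j incs)
  qed
  have "regs step_prog \<subseteq> {..<9 + k}"
    unfolding step_prog_def by (intro regs_select leaf) auto
  moreover have "regs evaluate \<subseteq> {..<9 + k}"
    unfolding evaluate_def regs.simps
    by (intro Un_least regs_select) (simp_all add: clear_def transfer transfer2 incs)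
  moreover have "regs (clears 9 k) \<subseteq> {..<9 + k}"
    using regs_clears[of 9 k] by (auto dest!: subsetD)
  ultimately show ?thesis
    by (simp add: search_def simulate_def run_loop_def read_choice_def divmod_loop_def rewind_def
        clear_def transfer transfer2 incs)
qed

text \<open>The factor \<open>2 ^ k\<close> counts the zero patterns; each copy holds
  \<open>k\<close> counter operations and two blocks of increments that write a state
  position.\<close>

lemma csize_leaf:
  assumes "j < base"
  shows "csize (leaf j i) \<le> 2 ^ k * (2 * k + 4 * length qs + 7)"
proof -
  let ?N = "length qs"
  obtain p d ops where j: "choices ! j = (p, d, ops)" by (cases "choices ! j")
  have eq: "(2 * k + 4 * ?N + 6) + 1 = 2 * k + 4 * ?N + 7" by simp
  have one: "1 * (2 * k + 4 * ?N + 7) \<le> 2 ^ k * (2 * k + 4 * ?N + 7)"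
    by (intro mult_le_mono1) simp
  have "index p \<le> ?N" "length ops = k" using choices_nth[OF assms j] index[of p] by auto
  then have "csize (with_tops 9 k (\<lambda>ts. IfTape (\<lambda>a. (p, d, ops) \<in> trans M (qs ! i) a ts)
      (ops_prog 9 ops ;; Move d ;; incs (index p) 0) (incs ?N 0))) + 1
    \<le> 2 ^ k * ((2 * k + 4 * ?N + 6) + 1)"
    using csize_ops_prog[of 9 ops, where ?'a = 'a] by (intro csize_with_tops) simp
  then have "csize (with_tops 9 k (\<lambda>ts. IfTape (\<lambda>a. (p, d, ops) \<in> trans M (qs ! i) a ts)
      (ops_prog 9 ops ;; Move d ;; incs (index p) 0) (incs ?N 0)))
    \<le> 2 ^ k * (2 * k + 4 * ?N + 7)" unfolding eq by linarith
  moreover have "2 * ?N + 1 \<le> 2 ^ k * (2 * k + 4 * ?N + 7)" using one by (rule order_trans[rotated]) simp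
  ultimately show ?thesis by (auto simp: leaf_def j running_def)
qed

lemma csize_search: "csize search \<le> size_bound k (length qs)"
proof -
  let ?N = "length qs"
  have four: "b + 1 + 3 = b + 4" and eighteen: "b + 15 + 3 = b + 18" for b :: nat by simp_all
  have "csize step_prog \<le> base * (((?N + 1) * (2 ^ k * (2 * k + 4 * ?N + 7) + 3) + 1) + 3) + 1"
    unfolding step_prog_def Suc_eq_plus1
    by (intro csize_select csize_leaf)
  then have "csize step_prog \<le> base * ((?N + 1) * (2 ^ k * (2 * k + 4 * ?N + 7) + 3) + 4) + 1"
    unfolding four .
  moreover have "csize read_choice \<le> 2 * base + 32"
    by (simp add: read_choice_def divmod_loop_def)
  moreover have "index (init_state M) \<le> ?N" using index[OF init_in_states] by simp
  moreover have "csize evaluate \<le> (?N + 1) * (4 * base * base + 18) + 3"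
  proof -
    have "csize (select 0 (Suc ?N) (\<lambda>i. if \<not> running i then Dec 6
       else if accepting i then Inc 7 ;; clear 6
       else transfer2 (base * base) 5 6 8 ;; transfer 1 8 5 ;; incs (base * base) 6) :: 'a com)
      \<le> (?N + 1) * ((4 * base * base + 15) + 3) + 1"
      unfolding Suc_eq_plus1 by (rule csize_select) simp
    then show ?thesis unfolding eighteen by (simp add: evaluate_def del: select.simps)
  qed
  moreover have "csize search = csize step_prog + csize read_choice + csize evaluate
      + 2 * index (init_state M) + 4 * k + 37"
    by (simp add: search_def simulate_def run_loop_def)
  ultimately show ?thesis unfolding size_bound_def length_choices[symmetric] by linarith
qed

end

section \<open>Complementation of a whole family\<close>

lemma complement:
  fixes k :: nat
  obtains K :: nat where
    "\<And>(M :: 'a ncta) A R. is_ncta k M \<Longrightarrow> solves k M (A, R) \<Longrightarrow>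
       \<exists>N :: 'a ncta. is_ncta 4 N \<and> card (states N) \<le> K * size_bound k (card (states M)) \<and>
         solves 4 N (R, A)"
proof (rule four_counters_suffice[of "9 + k", where ?'a = 'a])
  fix K :: nat
  assume K: "\<And>(P :: 'a com) F. regs P \<subseteq> {..<9 + k} \<Longrightarrow> F < 9 + k \<Longrightarrow>
       \<exists>N :: 'a ncta. is_ncta 4 N \<and> card (states N) \<le> K * csize P \<and>
         (\<forall>x h v. exec x P (0, \<lambda>_. 0) (h, v) \<longrightarrow>
            (if v F = 0 then \<exists>cs. accepting_path 4 N x cs else all_paths_rejecting 4 N x))"
  show thesis
  proof (rule that[of K])
    fix M :: "'a ncta" and A R
    assume M: "is_ncta k M" and sol: "solves k M (A, R)"
    then have "finite (states M)" by (simp add: is_ncta_def)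
    then obtain qs where qs: "distinct qs" "set qs = states M"
      using finite_distinct_list by blast
    interpret source k M qs by unfold_locales (use M qs in simp_all)
    \<comment> \<open>Register 7 is the flag for an accepting run of \<open>M\<close>; acceptance on
      a zero flag exchanges the two verdicts.\<close>
    obtain N :: "'a ncta" where N: "is_ncta 4 N" "card (states N) \<le> K * csize search"
      "\<And>x h v. exec x search (0, \<lambda>_. 0) (h, v) \<Longrightarrow>
         (if v 7 = 0 then \<exists>cs. accepting_path 4 N x cs else all_paths_rejecting 4 N x)"
      using K[OF regs_search, of 7] by auto
    have "card (states N) \<le> K * size_bound k (card (states M))"
      using N(2) csize_search distinct_card[OF qs(1)] qs(2)
      by (metis mult_le_mono2 order_trans)
    moreover have "solves 4 N (R, A)"
      unfolding solves_def fst_conv snd_conv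
    proof (intro conjI ballI)
      fix x assume "x \<in> R"
      then have "all_paths_rejecting k M x" using sol by (simp add: solves_def)
      then obtain h v where "exec x search (0, \<lambda>_. 0) (h, v)" "v 7 = 0"
        using search_accepts by blast
      with N(3)[of x h v] show "\<exists>cs. accepting_path 4 N x cs" by simp
    next
      fix x assume "x \<in> A"
      then obtain cs where "accepting_path k M x cs" using sol by (auto simp: solves_def)
      then obtain h v where "exec x search (0, \<lambda>_. 0) (h, v)" "v 7 \<noteq> 0"
        using search_rejects by blast
      with N(3)[of x h v] show "all_paths_rejecting 4 N x" by simp
    qed
    ultimately show "\<exists>N :: 'a ncta. is_ncta 4 N \<and>
        card (states N) \<le> K * size_bound k (card (states M)) \<and> solves 4 N (R, A)"
      using N(1) by blast
  qed
qed

text \<open>The constant \<open>K\<close> from \<open>complement\<close> is fixed before the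
  automaton, so it serves all members of the family. Monotonicity of \<open>size_bound\<close> then
  lets the polynomial bound replace the state count.\<close>

lemma co_two_NCT_subset: "co_class (two_NCT k :: 'a::finite family set) \<subseteq> two_NCT 4"
proof
  fix L' :: "'a family"
  assume "L' \<in> co_class (two_NCT k)"
  then obtain L where L: "L \<in> two_NCT k" "L' = (\<lambda>n. (snd (L n), fst (L n)))"
    by (auto simp: co_class_def)
  then obtain M p where M: "\<And>n. is_ncta k (M n)" "\<And>n. solves k (M n) (L n)"
    and p: "\<And>n. card (states (M n)) \<le> poly p n" and prom: "\<And>n. is_promise_problem (L n)"
    by (auto simp: two_NCT_def polynomial_size_def)
  obtain K where K: "\<And>(M :: 'a ncta) A R. is_ncta k M \<Longrightarrow> solves k M (A, R) \<Longrightarrow>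
       \<exists>N :: 'a ncta. is_ncta 4 N \<and> card (states N) \<le> K * size_bound k (card (states M)) \<and>
         solves 4 N (R, A)"
    using complement[of k, where ?'a = 'a] by metis
  have "\<exists>N. is_ncta 4 N \<and> card (states N) \<le> K * size_bound k (card (states (M n))) \<and>
      solves 4 N (L' n)" for n
    using K[OF M(1), of n "fst (L n)" "snd (L n)"] M(2)[of n] L(2) by simp
  then obtain N where N: "\<And>n. is_ncta 4 (N n)" "\<And>n. solves 4 (N n) (L' n)"
    "\<And>n. card (states (N n)) \<le> K * size_bound k (card (states (M n)))"
    by metis
  obtain q where q: "\<And>n. K * size_bound k (poly p n) = poly q n"
    using size_bound_poly by metis
  have "card (states (N n)) \<le> poly q n" for n
    unfolding q[symmetric] using N(3) by (rule order_trans) (intro mult_le_mono2 size_bound_mono p)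
  then have "polynomial_size N" by (auto simp: polynomial_size_def)
  moreover have "is_promise_problem (L' n)" for n
    using prom[of n] L(2) by (auto simp: is_promise_problem_def)
  ultimately show "L' \<in> two_NCT 4"
    using N by (auto simp: two_NCT_def)
qed

text \<open>Swapping the two sides of a promise problem is an involution.\<close>

lemma subset_co_class_if_co_class_subset:
  assumes "co_class C \<subseteq> C"
  shows "C \<subseteq> co_class C"
proof
  fix L assume "L \<in> C"
  then have "(\<lambda>n. (snd (L n), fst (L n))) \<in> C" using assms by (auto simp: co_class_def)
  then show "L \<in> co_class C" by (force simp: co_class_def)
qed

theorem theorem3p4:
  shows "(\<forall>k\<ge>4. co_class (two_NCT k :: 'a::finite family set) \<subseteq> two_NCT 4) \<and>
         (two_NCT 4 :: 'a family set) = co_class (two_NCT 4)"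
  using co_two_NCT_subset subset_co_class_if_co_class_subset[OF co_two_NCT_subset] by blast

end
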